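(* Let $S=[M\mid\Lambda]$ with $M=\begin{pmatrix}A&B\\C&D\end{pmatrix}$ real, $\det M=1$, $B>0$, and $\Lambda=(p,q)^\top\in\mathbb R^2$. Let $\{\mathscr V_S^n:n\in\mathbb Z\}$ be a special affine multiresolution analysis (SAMRA) of $L^2(\mathbb R)$ associated with the scaling function $\varphi\in L^2(\mathbb R)$. For $k\in\mathbb Z$ put $$h_k=\sqrt2\int_{\mathbb R}\exp\Big\{-\tfrac{i}{2B}\big(\tfrac{Ak^2}{4}+pk\big)\Big\}\,\varphi(x)\,\overline{\varphi(2x-k)}\,dx,$$ $$d_k=(-1)^{1-k}\,\overline{h_{1-k}}\,\exp\Big\{-\tfrac{i}{2B}\Big(\tfrac{A\left((1-k)^2+k^2\right)}{4}+p\Big)\Big\}.$$ Then there exists a function $\psi\in L^2(\mathbb R)$ such that $$\psi_{S,0,0}(x)=\sqrt2\sum_{k\in\mathbb Z} d_k\,\exp\Big\{-\tfrac{i}{2B}\Big(A\big(x^2-\tfrac{k^2}{4}\big)+2p\big(x-\tfrac k2\big)\Big)\Big\}\,\varphi(2x-k),$$ (series convergent in $L^2(\mathbb R)$), and consequently the system $\{\psi_{S,k,n}:k,n\in\mathbb Z\}$ forms an orthonormal basis of $L^2(\mathbb R)$.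
   Context: For $g\in L^2(\mathbb R)$ and $k,n\in\mathbb Z$, write $$g_{S,k,n}(x)=2^{k/2}\exp\Big\{-\tfrac{i}{2B}\Big(A\big(x^2-(\tfrac{n}{2^k})^2\big)+2p\big(x-\tfrac{n}{2^k}\big)\Big)\Big\}\,g(2^kx-n);$$ this defines $\varphi_{S,k,n}$ and $\psi_{S,k,n}$. A SAMRA associated with $S$ is a collection $\{\mathscr V_S^k:k\in\mathbb Z\}$ of closed subspaces of $L^2(\mathbb R)$ such that: (a) $\mathscr V_S^k\subset\mathscr V_S^{k+1}$ for all $k\in\mathbb Z$; (b) for all $k\in\mathbb Z$, $f(x)\in\mathscr V_S^k$ if and only if $e^{\frac{i}{2B}(3Ax^2+2xp)}f(2x)\in\mathscr V_S^{k+1}$; (c) $\bigcap_{k\in\mathbb Z}\mathscr V_S^k=\{0\}$ and $\overline{\bigcup_{k\in\mathbb Z}\mathscr V_S^k}=L^2(\mathbb R)$; (d) there exists a function $\varphi\in L^2(\mathbb R)$ (the scaling function) such that $\{\varphi_{S,0,n}(x)=e^{-\frac{i}{2B}(A(x^2-n^2)+2p(x-n))}\varphi(x-n):n\in\mathbb Z\}$ is an orthonormal basis of $\mathscr V_S^0$. *)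

theory Defs
  imports "HOL-Analysis.Analysis"
begin

text \<open>
  Elements of \<open>L\<^sup>2(\<real>)\<close> are represented by functions, not by equivalence classes. Sets of
  functions that stand for subsets of \<open>L\<^sup>2(\<real>)\<close> are saturated under almost-everywhere equality
  whenever they are closed in the sense of \<open>L2_closure\<close> below.
\<close>

definition L2 :: "(real \<Rightarrow> complex) set" where
  "L2 = {f. f \<in> borel_measurable lborel \<and> integrable lborel (\<lambda>x. (norm (f x))\<^sup>2)}"

definition L2_inner :: "(real \<Rightarrow> complex) \<Rightarrow> (real \<Rightarrow> complex) \<Rightarrow> complex" where
  "L2_inner f g = (LINT x|lborel. f x * cnj (g x))"

definition L2_norm :: "(real \<Rightarrow> complex) \<Rightarrow> real" where
  "L2_norm f = sqrt (LINT x|lborel. (norm (f x))\<^sup>2)"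

text \<open>Only meaningful for subsets of \<open>L2\<close>, as the integral of a non-integrable function is 0.\<close>

definition L2_closure :: "(real \<Rightarrow> complex) set \<Rightarrow> (real \<Rightarrow> complex) set" where
  "L2_closure U = {f \<in> L2. \<exists>s. (\<forall>j::nat. s j \<in> U) \<and> (\<lambda>j. L2_norm (\<lambda>x. s j x - f x)) \<longlonglongrightarrow> 0}"

definition L2_closed_subspace :: "(real \<Rightarrow> complex) set \<Rightarrow> bool" where
  "L2_closed_subspace V \<longleftrightarrow>
     V \<subseteq> L2 \<and> (\<lambda>x. 0) \<in> V \<and>
     (\<forall>f\<in>V. \<forall>g\<in>V. (\<lambda>x. f x + g x) \<in> V) \<and>
     (\<forall>c. \<forall>f\<in>V. (\<lambda>x. c * f x) \<in> V) \<and>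
     L2_closure V \<subseteq> V"

definition complex_span :: "(real \<Rightarrow> complex) set \<Rightarrow> (real \<Rightarrow> complex) set" where
  "complex_span U = {(\<lambda>x. \<Sum>u\<in>F. c u * u x) | F c. finite F \<and> F \<subseteq> U}"

text \<open>Orthonormality is that of the indexed family: distinct indices give orthogonal functions.\<close>

definition L2_orthonormal_basis ::
    "('i \<Rightarrow> real \<Rightarrow> complex) \<Rightarrow> (real \<Rightarrow> complex) set \<Rightarrow> bool" where
  "L2_orthonormal_basis e V \<longleftrightarrow>
     (\<forall>i. e i \<in> L2) \<and>
     (\<forall>i j. L2_inner (e i) (e j) = (if i = j then 1 else 0)) \<and>
     L2_closure (complex_span (range e)) = V"

text \<open>
  The \<open>L\<^sup>2\<close> counterpart of \<open>has_sum\<close> over the whole index type: convergence in norm along the net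
  of finite partial sums.
\<close>

definition L2_has_sum :: "('i \<Rightarrow> real \<Rightarrow> complex) \<Rightarrow> (real \<Rightarrow> complex) \<Rightarrow> bool" where
  "L2_has_sum u f \<longleftrightarrow>
     (\<forall>i. u i \<in> L2) \<and> f \<in> L2 \<and>
     ((\<lambda>F. L2_norm (\<lambda>x. (\<Sum>i\<in>F. u i x) - f x)) \<longlongrightarrow> 0) (finite_subsets_at_top UNIV)"

text \<open>
  A pair \<open>(M, \<Lambda>)\<close> encodes \<open>S = [M | \<Lambda>]\<close>, where \<open>M\<close> has the rows \<open>(A, B)\<close> and \<open>(C, D)\<close> and
  \<open>\<Lambda> = (p, q)\<close>.
\<close>

type_synonym special_affine = "(real^2^2) \<times> (real^2)"

definition coef_A :: "special_affine \<Rightarrow> real" where "coef_A S = fst S $ 1 $ 1"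
definition coef_B :: "special_affine \<Rightarrow> real" where "coef_B S = fst S $ 1 $ 2"
definition coef_p :: "special_affine \<Rightarrow> real" where "coef_p S = snd S $ 1"

definition sa_atom ::
    "special_affine \<Rightarrow> int \<Rightarrow> int \<Rightarrow> (real \<Rightarrow> complex) \<Rightarrow> real \<Rightarrow> complex" where
  "sa_atom S k n g x =
     of_real (2 powr (of_int k / 2)) *
     exp (- (\<i> / of_real (2 * coef_B S)) *
       of_real (coef_A S * (x\<^sup>2 - (of_int n / 2 powi k)\<^sup>2) +
                2 * coef_p S * (x - of_int n / 2 powi k))) *
     g (2 powi k * x - of_int n)"

definition scaling_function ::
    "special_affine \<Rightarrow> (int \<Rightarrow> (real \<Rightarrow> complex) set) \<Rightarrow> (real \<Rightarrow> complex) \<Rightarrow> bool" where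
  "scaling_function S V \<phi> \<longleftrightarrow>
     \<phi> \<in> L2 \<and> L2_orthonormal_basis (\<lambda>n. sa_atom S 0 n \<phi>) (V 0)"

definition SAMRA :: "special_affine \<Rightarrow> (int \<Rightarrow> (real \<Rightarrow> complex) set) \<Rightarrow> bool" where
  "SAMRA S V \<longleftrightarrow>
     (\<forall>k. L2_closed_subspace (V k)) \<and>
     (\<forall>k. V k \<subseteq> V (k + 1)) \<and>
     (\<forall>k. \<forall>f\<in>L2. f \<in> V k \<longleftrightarrow>
        (\<lambda>x. exp (\<i> / of_real (2 * coef_B S) *
               of_real (3 * coef_A S * x\<^sup>2 + 2 * x * coef_p S)) * f (2 * x)) \<in> V (k + 1)) \<and>
     (\<Inter>k. V k) = {f \<in> L2. AE x in lborel. f x = 0} \<and>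
     L2_closure (\<Union>k. V k) = L2 \<and>
     (\<exists>\<phi>. scaling_function S V \<phi>)"

end

theory Submission
  imports Defs
begin

text \<open>
  Write \<open>E x = exp (- \<i> (A x\<^sup>2 + 2 p x) / (2 B))\<close>. Every function \<open>sa_atom S k n g\<close> is, up to a
  constant of modulus one, the product of \<open>E\<close> with the ordinary dyadic atom
  \<open>2\<^sup>k\<^sup>/\<^sup>2 g (2\<^sup>k x - n)\<close>. Multiplication by \<open>E\<close> is unitary, and it turns the ordinary dilation
  \<open>f x \<mapsto> f (2 x)\<close> into the dilation of a SAMRA. Hence the spaces of all \<open>f\<close> with \<open>E f \<in> V k\<close> form an
  ordinary multiresolution analysis \<open>W\<close> with scaling function \<open>\<phi>\<close>, and the chirps in \<open>h\<close> and \<open>d\<close> cancel: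
  with \<open>a j = \<langle>\<phi>, \<surd>2 \<phi>(2\<cdot> - j)\<rangle>\<close>, the series that defines \<open>\<psi>\<close> has the coefficients
  \<open>b j = (-1)\<^sup>1\<^sup>-\<^sup>j cnj (a (1 - j))\<close> with respect to the orthonormal basis \<open>\<surd>2 \<phi>(2\<cdot> - j)\<close> of \<open>W 1\<close>.

  For the ordinary multiresolution analysis the argument uses coefficient sequences and no Fourier
  transform. Orthonormality of the integer translates of \<open>\<phi>\<close> says that the even shifts of \<open>a\<close> are
  orthonormal in \<open>\<ell>\<^sup>2\<close>; a reflection of the summation index gives the same for \<open>b\<close>, and an alternating
  sign makes the even shifts of \<open>a\<close> and \<open>b\<close> orthogonal to each other. The translates of \<open>\<phi>\<close> and \<open>\<psi>\<close>
  together span \<open>W 1\<close>, because for every basis vector \<open>\<surd>2 \<phi>(2\<cdot> - j)\<close> Bessel's inequality is an equality: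
  \<open>\<Sum>\<^sub>n \<bar>a (j - 2n)\<bar>\<^sup>2 + \<bar>b (j - 2n)\<bar>\<^sup>2 = \<Sum>\<^sub>i \<bar>a i\<bar>\<^sup>2 = 1\<close> (lemma \<open>atom_next_in_split\<close>).

  Let \<open>P k\<close> be the orthogonal projection onto \<open>W k\<close>. By the same splitting at scale \<open>k\<close>,
  \<open>P (k + 1) f - P k f\<close> lies in the closed span of the wavelets at scale \<open>k\<close>. Finally \<open>P m f\<close> tends
  to \<open>f\<close> by density of the union, and \<open>P (- m) f\<close> tends to \<open>0\<close> since it is a Cauchy sequence whose limit
  lies in every \<open>W k\<close>; so \<open>f\<close> is in the closed span of all wavelets. This last step, like the existence
  of \<open>\<psi>\<close>, rests on the completeness of \<open>L\<^sup>2\<close> (lemma \<open>L2_complete\<close>).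
\<close>

section \<open>The semi-inner product on square-integrable functions\<close>

lemma L2_measurable: "f \<in> L2 \<Longrightarrow> f \<in> borel_measurable borel"
  by (simp add: L2_def)

lemma L2_integrable: "f \<in> L2 \<Longrightarrow> integrable lborel (\<lambda>x. (norm (f x))\<^sup>2)"
  by (simp add: L2_def)

lemma L2_I:
  "f \<in> borel_measurable borel \<Longrightarrow> integrable lborel (\<lambda>x. (norm (f x))\<^sup>2) \<Longrightarrow> f \<in> L2"
  by (simp add: L2_def)

lemma L2_zero [simp]: "(\<lambda>x. 0) \<in> L2"
  by (simp add: L2_def)

lemma L2_scale [intro]:
  assumes "f \<in> L2" shows "(\<lambda>x. c * f x) \<in> L2"
  using assms by (auto simp: L2_def norm_mult power_mult_distrib)

lemma norm_add_square_le: "(norm (a + b :: complex))\<^sup>2 \<le> 2 * (norm a)\<^sup>2 + 2 * (norm b)\<^sup>2"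
proof -
  have "(norm (a + b))\<^sup>2 \<le> (norm a + norm b)\<^sup>2"
    by (intro power_mono norm_triangle_ineq norm_ge_zero)
  also have "\<dots> \<le> 2 * (norm a)\<^sup>2 + 2 * (norm b)\<^sup>2"
    using zero_le_power2[of "norm a - norm b"] by (simp add: power2_eq_square algebra_simps)
  finally show ?thesis .
qed

lemma L2_add [intro]:
  assumes "f \<in> L2" "g \<in> L2" shows "(\<lambda>x. f x + g x) \<in> L2"
proof (rule L2_I)
  have [measurable]: "f \<in> borel_measurable borel" "g \<in> borel_measurable borel"
    using assms by (auto intro: L2_measurable)
  show "(\<lambda>x. f x + g x) \<in> borel_measurable borel" by measurable
  show "integrable lborel (\<lambda>x. (norm (f x + g x))\<^sup>2)"
  proof (rule Bochner_Integration.integrable_bound)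
    show "integrable lborel (\<lambda>x. 2 * (norm (f x))\<^sup>2 + 2 * (norm (g x))\<^sup>2)"
      using assms by (intro Bochner_Integration.integrable_add integrable_mult_right L2_integrable)
    show "AE x in lborel. norm ((norm (f x + g x))\<^sup>2)
            \<le> norm (2 * (norm (f x))\<^sup>2 + 2 * (norm (g x))\<^sup>2)"
      using norm_add_square_le by (intro AE_I2) (auto intro: order_trans)
  qed measurable
qed

lemma L2_diff [intro]:
  assumes "f \<in> L2" "g \<in> L2" shows "(\<lambda>x. f x - g x) \<in> L2"
  using L2_add[OF assms(1) L2_scale[OF assms(2), of "-1"]] by simp

lemma L2_sum [intro]:
  assumes "\<And>i. i \<in> F \<Longrightarrow> u i \<in> L2" shows "(\<lambda>x. \<Sum>i\<in>F. u i x) \<in> L2"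
  using assms by (induction F rule: infinite_finite_induct) auto

lemma borel_measurable_cnj [measurable (raw)]:
  assumes "f \<in> borel_measurable N" shows "(\<lambda>x. cnj (f x)) \<in> borel_measurable N"
  by (rule borel_measurable_continuous_on[OF _ assms]) (intro continuous_intros)

lemma L2_inner_integrable:
  assumes "f \<in> L2" "g \<in> L2" shows "integrable lborel (\<lambda>x. f x * cnj (g x))"
proof (rule Bochner_Integration.integrable_bound)
  have [measurable]: "f \<in> borel_measurable borel" "g \<in> borel_measurable borel"
    using assms by (auto intro: L2_measurable)
  show "(\<lambda>x. f x * cnj (g x)) \<in> borel_measurable lborel" by measurable
  show "integrable lborel (\<lambda>x. (norm (f x))\<^sup>2 + (norm (g x))\<^sup>2)"
    using assms by (intro Bochner_Integration.integrable_add L2_integrable)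
  have "norm (f x) * norm (g x) \<le> (norm (f x))\<^sup>2 + (norm (g x))\<^sup>2" for x
    using zero_le_power2[of "norm (f x) - norm (g x)"] zero_le_power2[of "norm (f x)"]
      zero_le_power2[of "norm (g x)"]
    unfolding power2_diff by linarith
  then show "AE x in lborel. norm (f x * cnj (g x)) \<le> norm ((norm (f x))\<^sup>2 + (norm (g x))\<^sup>2)"
    by (simp add: norm_mult)
qed

lemma L2_inner_commute: "L2_inner g f = cnj (L2_inner f g)"
  unfolding L2_inner_def
  by (subst Bochner_Integration.integral_cnj[symmetric]) (simp add: mult.commute)

lemma L2_inner_diff_left:
  "f \<in> L2 \<Longrightarrow> g \<in> L2 \<Longrightarrow> h \<in> L2 \<Longrightarrow>
     L2_inner (\<lambda>x. f x - g x) h = L2_inner f h - L2_inner g h"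
  unfolding L2_inner_def
  by (simp add: ring_distribs Bochner_Integration.integral_diff L2_inner_integrable)

lemma L2_inner_scale_left: "L2_inner (\<lambda>x. c * f x) h = c * L2_inner f h"
  unfolding L2_inner_def by (simp add: mult.assoc)

lemma L2_inner_sum_left:
  assumes "\<And>i. i \<in> F \<Longrightarrow> u i \<in> L2" "h \<in> L2"
  shows "L2_inner (\<lambda>x. \<Sum>i\<in>F. u i x) h = (\<Sum>i\<in>F. L2_inner (u i) h)"
  unfolding L2_inner_def sum_distrib_right
  by (intro Bochner_Integration.integral_sum L2_inner_integrable assms)

lemma L2_inner_diff_right:
  "f \<in> L2 \<Longrightarrow> g \<in> L2 \<Longrightarrow> h \<in> L2 \<Longrightarrow>
     L2_inner h (\<lambda>x. f x - g x) = L2_inner h f - L2_inner h g"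
  by (metis L2_inner_commute L2_inner_diff_left complex_cnj_diff)

lemma L2_inner_scale_right: "L2_inner h (\<lambda>x. c * f x) = cnj c * L2_inner h f"
  by (metis L2_inner_commute L2_inner_scale_left complex_cnj_mult)

lemma L2_inner_sum_right:
  assumes "\<And>i. i \<in> F \<Longrightarrow> u i \<in> L2" "h \<in> L2"
  shows "L2_inner h (\<lambda>x. \<Sum>i\<in>F. u i x) = (\<Sum>i\<in>F. L2_inner h (u i))"
  by (subst L2_inner_commute, subst L2_inner_sum_left[OF assms])
    (simp_all flip: L2_inner_commute)

lemma L2_norm_nonneg [simp]: "L2_norm f \<ge> 0"
  by (simp add: L2_norm_def)

lemma L2_norm_square: "(L2_norm f)\<^sup>2 = (LINT x|lborel. (norm (f x))\<^sup>2)"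
  by (simp add: L2_norm_def)

lemma L2_inner_self: "L2_inner f f = of_real ((L2_norm f)\<^sup>2)"
  unfolding L2_inner_def L2_norm_square integral_complex_of_real[symmetric]
  by (simp only: complex_norm_square)

lemma L2_norm_zero [simp]: "L2_norm (\<lambda>x. 0) = 0"
  by (simp add: L2_norm_def)

lemma L2_norm_scale: "L2_norm (\<lambda>x. c * f x) = norm c * L2_norm f"
  by (simp add: L2_norm_def norm_mult power_mult_distrib real_sqrt_mult)

lemma L2_norm_minus_commute: "L2_norm (\<lambda>x. f x - g x) = L2_norm (\<lambda>x. g x - f x)"
  by (simp add: L2_norm_def norm_minus_commute)

lemma L2_norm_diff_square:
  assumes "f \<in> L2" "g \<in> L2"
  shows "(L2_norm (\<lambda>x. f x - g x))\<^sup>2 = (L2_norm f)\<^sup>2 - 2 * Re (L2_inner f g) + (L2_norm g)\<^sup>2"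
proof -
  have "of_real ((L2_norm (\<lambda>x. f x - g x))\<^sup>2) =
      of_real ((L2_norm f)\<^sup>2) - (L2_inner f g + cnj (L2_inner f g)) + complex_of_real ((L2_norm g)\<^sup>2)"
    using assms
    by (simp add: L2_inner_self[symmetric] L2_inner_diff_left L2_inner_diff_right L2_diff
        L2_inner_commute[of g f] del: of_real_power)
  then show ?thesis
    unfolding complex_add_cnj of_real_diff[symmetric] of_real_add[symmetric] of_real_eq_iff
    by simp
qed

lemma L2_norm_eq_0_iff:
  assumes "f \<in> L2" shows "L2_norm f = 0 \<longleftrightarrow> (AE x in lborel. f x = 0)"
  using integral_nonneg_eq_0_iff_AE[OF L2_integrable[OF assms]]
  by (simp add: L2_norm_def)

lemma L2_Cauchy_Schwarz:
  assumes "f \<in> L2" "g \<in> L2"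
  shows "norm (L2_inner f g) \<le> L2_norm f * L2_norm g"
proof (cases "L2_norm g = 0")
  case True
  then have "AE x in lborel. g x = 0" using L2_norm_eq_0_iff assms by blast
  then have "AE x in lborel. f x * cnj (g x) = 0" by eventually_elim simp
  then have "L2_inner f g = 0" unfolding L2_inner_def by (rule integral_eq_zero_AE)
  then show ?thesis using True by simp
next
  case False
  \<comment> \<open>\<open>c * g\<close> is the orthogonal projection of \<open>f\<close> onto the line through \<open>g\<close>.\<close>
  define c where "c = L2_inner f g / of_real ((L2_norm g)\<^sup>2)"
  have "0 \<le> (L2_norm (\<lambda>x. f x - c * g x))\<^sup>2" by simp
  also have "\<dots> = (L2_norm f)\<^sup>2 - 2 * Re (cnj c * L2_inner f g) + (norm c * L2_norm g)\<^sup>2"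
    using assms by (simp add: L2_norm_diff_square L2_scale L2_inner_scale_right L2_norm_scale)
  also have "cnj c * L2_inner f g = of_real ((norm (L2_inner f g))\<^sup>2 / (L2_norm g)\<^sup>2)"
    unfolding c_def by (simp add: complex_norm_square[unfolded of_real_power] mult.commute)
  also have "(norm c * L2_norm g)\<^sup>2 = (norm (L2_inner f g))\<^sup>2 / (L2_norm g)\<^sup>2"
  proof -
    have "norm c = norm (L2_inner f g) / (L2_norm g)\<^sup>2"
      unfolding c_def by (simp add: norm_divide norm_power)
    then show ?thesis using False by (simp add: field_simps power2_eq_square)
  qed
  finally have "(norm (L2_inner f g))\<^sup>2 / (L2_norm g)\<^sup>2 \<le> (L2_norm f)\<^sup>2" by simp
  then have "(norm (L2_inner f g))\<^sup>2 \<le> (L2_norm f * L2_norm g)\<^sup>2"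
    using False by (simp add: divide_le_eq power_mult_distrib)
  then show ?thesis by (simp add: power2_le_iff_abs_le)
qed

lemma L2_norm_triangle_diff:
  assumes "f \<in> L2" "g \<in> L2" "h \<in> L2"
  shows "L2_norm (\<lambda>x. f x - h x) \<le> L2_norm (\<lambda>x. f x - g x) + L2_norm (\<lambda>x. g x - h x)"
proof -
  define u v where "u = (\<lambda>x. f x - g x)" and "v = (\<lambda>x. h x - g x)"
  have uv: "u \<in> L2" "v \<in> L2" using assms by (auto simp: u_def v_def)
  have "(L2_norm (\<lambda>x. u x - v x))\<^sup>2 \<le> (L2_norm u + L2_norm v)\<^sup>2"
  proof -
    have "- Re (L2_inner u v) \<le> L2_norm u * L2_norm v"
      using L2_Cauchy_Schwarz[OF uv] abs_Re_le_cmod[of "L2_inner u v"] by linarith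
    then show ?thesis
      unfolding L2_norm_diff_square[OF uv] power2_sum by linarith
  qed
  then have "L2_norm (\<lambda>x. u x - v x) \<le> L2_norm u + L2_norm v"
    by (rule power2_le_imp_le) simp
  then show ?thesis
    by (simp add: u_def v_def L2_norm_minus_commute[of h g])
qed

lemma L2_norm_triangle:
  assumes "f \<in> L2" "g \<in> L2"
  shows "L2_norm (\<lambda>x. f x + g x) \<le> L2_norm f + L2_norm g"
  using L2_norm_triangle_diff[OF assms(1) L2_zero L2_scale[OF assms(2), of "-1"]]
  by (simp add: L2_norm_def)

section \<open>Completeness of the space of square-integrable functions\<close>

text \<open>
  Riesz-Fischer. Along a subsequence with \<open>\<parallel>s\<^sub>k\<^sub>+\<^sub>1 - s\<^sub>k\<parallel>\<^sup>2 \<le> 8\<^sup>-\<^sup>k\<close> the function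
  \<open>\<Sum>\<^sub>k 4\<^sup>k \<bar>s\<^sub>k\<^sub>+\<^sub>1 - s\<^sub>k\<bar>\<^sup>2\<close> has a finite integral, so almost everywhere the increments are at most
  geometrically small and the subsequence converges; Fatou's lemma bounds the distance to the limit.
\<close>

lemma nn_integral_L2:
  assumes "f \<in> L2"
  shows "(\<integral>\<^sup>+x. ennreal ((norm (f x))\<^sup>2) \<partial>lborel) = ennreal ((L2_norm f)\<^sup>2)"
  unfolding L2_norm_square using assms
  by (intro nn_integral_eq_integral L2_integrable) auto

lemma convergent_of_geometric_increments:
  fixes s :: "nat \<Rightarrow> complex"
  assumes "(\<Sum>k. ennreal (4 ^ k * (norm (s (Suc k) - s k))\<^sup>2)) \<noteq> \<infinity>"
  shows "convergent s"
proof -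
  have sm: "summable (\<lambda>k. 4 ^ k * (norm (s (Suc k) - s k))\<^sup>2)"
    using assms by (intro summable_suminf_not_top) auto
  then have "Bseq (\<lambda>k. 4 ^ k * (norm (s (Suc k) - s k))\<^sup>2)"
    by (intro convergent_imp_Bseq summable_LIMSEQ_zero[THEN convergentI])
  then obtain K where K: "K > 0" "\<And>k. norm (4 ^ k * (norm (s (Suc k) - s k))\<^sup>2) \<le> K"
    by (auto simp: Bseq_def)
  have bd: "norm (s (Suc k) - s k) \<le> sqrt K * (1/2) ^ k" for k
  proof (rule power2_le_imp_le)
    have "4 ^ k * (norm (s (Suc k) - s k))\<^sup>2 \<le> K" using K(2)[of k] by simp
    moreover have "(sqrt K * (1/2) ^ k)\<^sup>2 = K / 4 ^ k"
      using K(1) by (simp add: power_mult_distrib power_divide flip: power_mult)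
        (simp add: power_mult mult.commute[of k])
    moreover have "(norm (s (Suc k) - s k))\<^sup>2 \<le> K / 4 ^ k"
      using calculation(1) by (simp add: le_divide_eq mult.commute)
    ultimately show "(norm (s (Suc k) - s k))\<^sup>2 \<le> (sqrt K * (1/2) ^ k)\<^sup>2"
      by simp
  qed (use K(1) in simp)
  have "summable (\<lambda>k. s (Suc k) - s k)"
    by (rule summable_comparison_test'[OF _ bd]) (intro summable_mult summable_geometric, simp)
  then have "convergent (\<lambda>n. (\<Sum>k<n. s (Suc k) - s k))" by (simp add: summable_iff_convergent)
  then have "convergent (\<lambda>n. (s n - s 0) + s 0)"
    unfolding sum_lessThan_telescope by (intro convergent_add convergent_const)
  then show ?thesis by simp
qed

lemma fast_Cauchy_subsequence:
  fixes d :: "nat \<Rightarrow> nat \<Rightarrow> real"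
  assumes Cau: "\<And>e. e > 0 \<Longrightarrow> \<exists>N. \<forall>m\<ge>N. \<forall>n\<ge>N. d m n < e" and e: "\<And>k. e k > 0"
  obtains r :: "nat \<Rightarrow> nat" where "strict_mono r" "\<And>k. d (r (Suc k)) (r k) < e k"
proof -
  obtain N where N: "\<And>k m n. m \<ge> N k \<Longrightarrow> n \<ge> N k \<Longrightarrow> d m n < e k"
    using Cau[OF e] by metis
  define r where "r = rec_nat (N 0) (\<lambda>k m. max (Suc m) (N (Suc k)))"
  have ge: "r k \<ge> N k" for k by (cases k) (auto simp: r_def)
  have lt: "r (Suc k) > r k" for k by (simp add: r_def less_max_iff_disj)
  show thesis
  proof (rule that)
    show "strict_mono r" using lt by (simp add: strict_mono_Suc_iff)
    show "d (r (Suc k)) (r k) < e k" for k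
      using N[of k "r (Suc k)" "r k"] ge[of k] lt[of k] by linarith
  qed
qed

lemma L2_complete:
  assumes s: "\<And>n. s n \<in> L2"
    and Cau: "\<And>e. e > 0 \<Longrightarrow> \<exists>N. \<forall>m\<ge>N. \<forall>n\<ge>N. L2_norm (\<lambda>x. s m x - s n x) < e"
  obtains f where "f \<in> L2" "(\<lambda>n. L2_norm (\<lambda>x. s n x - f x)) \<longlonglongrightarrow> 0"
proof -
  have [measurable]: "s n \<in> borel_measurable borel" for n using s by (rule L2_measurable)
  have "\<exists>r::nat \<Rightarrow> nat. strict_mono r \<and>
      (\<forall>k. L2_norm (\<lambda>x. s (r (Suc k)) x - s (r k) x) < sqrt ((1/8) ^ k))"
    by (rule fast_Cauchy_subsequence[where d = "\<lambda>m n. L2_norm (\<lambda>x. s m x - s n x)" and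
          e = "\<lambda>k. sqrt ((1/8) ^ k)"]) (use Cau in auto)
  then obtain r :: "nat \<Rightarrow> nat" where r: "strict_mono r"
    and fast: "\<And>k. L2_norm (\<lambda>x. s (r (Suc k)) x - s (r k) x) < sqrt ((1/8) ^ k)"
    by blast
  define t where "t = (\<lambda>k x. ennreal (4 ^ k * (norm (s (r (Suc k)) x - s (r k) x))\<^sup>2))"
  have "(\<integral>\<^sup>+x. (\<Sum>k. t k x) \<partial>lborel) = (\<Sum>k. \<integral>\<^sup>+x. t k x \<partial>lborel)"
    unfolding t_def by (rule nn_integral_suminf) measurable
  also have "\<dots> \<le> (\<Sum>k. ennreal ((1/2) ^ k))"
  proof (intro suminf_le allI)
    fix k
    have "(\<integral>\<^sup>+x. t k x \<partial>lborel) =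
        ennreal (4 ^ k) * (\<integral>\<^sup>+x. ennreal ((norm (s (r (Suc k)) x - s (r k) x))\<^sup>2) \<partial>lborel)"
      unfolding t_def by (subst nn_integral_cmult[symmetric]) (auto simp: ennreal_mult)
    also have "\<dots> = ennreal (4 ^ k * (L2_norm (\<lambda>x. s (r (Suc k)) x - s (r k) x))\<^sup>2)"
      by (simp add: nn_integral_L2 L2_diff s ennreal_mult)
    also have "\<dots> \<le> ennreal ((1/2) ^ k)"
    proof (rule ennreal_leI)
      have "(L2_norm (\<lambda>x. s (r (Suc k)) x - s (r k) x))\<^sup>2 \<le> (sqrt ((1/8) ^ k))\<^sup>2"
        using fast[of k] by (intro power_mono) auto
      then have "4 ^ k * (L2_norm (\<lambda>x. s (r (Suc k)) x - s (r k) x))\<^sup>2 \<le> 4 ^ k * (1/8) ^ k"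
        by simp
      also have "\<dots> = (1/2 :: real) ^ k" by (simp flip: power_mult_distrib)
      finally show "4 ^ k * (L2_norm (\<lambda>x. s (r (Suc k)) x - s (r k) x))\<^sup>2 \<le> (1/2) ^ k" .
    qed
    finally show "(\<integral>\<^sup>+x. t k x \<partial>lborel) \<le> ennreal ((1/2) ^ k)" .
  qed auto
  also have "\<dots> < \<infinity>"
    by (subst suminf_ennreal2) (auto intro: summable_geometric)
  finally have "(\<integral>\<^sup>+x. (\<Sum>k. t k x) \<partial>lborel) \<noteq> \<infinity>" by simp
  then have "AE x in lborel. (\<Sum>k. t k x) \<noteq> \<infinity>"
    by (intro nn_integral_PInf_AE) (auto simp: t_def)
  then have conv: "AE x in lborel. convergent (\<lambda>k. s (r k) x)"
    unfolding t_def by eventually_elim (rule convergent_of_geometric_increments)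
  define f where "f = (\<lambda>x. lim (\<lambda>k. s (r k) x))"
  have f_meas [measurable]: "f \<in> borel_measurable borel"
    unfolding f_def by measurable
  have lim: "AE x in lborel. (\<lambda>k. s (r k) x) \<longlonglongrightarrow> f x"
    using conv unfolding f_def by eventually_elim (simp add: convergent_LIMSEQ_iff)
  have close: "\<exists>N. \<forall>n\<ge>N. (\<integral>\<^sup>+x. ennreal ((norm (s n x - f x))\<^sup>2) \<partial>lborel) \<le> ennreal (e\<^sup>2)"
    if "e > 0" for e
  proof -
    obtain N where N: "\<And>m n. m \<ge> N \<Longrightarrow> n \<ge> N \<Longrightarrow> L2_norm (\<lambda>x. s m x - s n x) < e"
      using Cau[OF \<open>e > 0\<close>] by blast
    have "(\<integral>\<^sup>+x. ennreal ((norm (s n x - f x))\<^sup>2) \<partial>lborel) \<le> ennreal (e\<^sup>2)" if "n \<ge> N" for n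
    proof -
      have "(\<integral>\<^sup>+x. ennreal ((norm (s n x - f x))\<^sup>2) \<partial>lborel) =
          (\<integral>\<^sup>+x. liminf (\<lambda>k. ennreal ((norm (s n x - s (r k) x))\<^sup>2)) \<partial>lborel)"
      proof (rule nn_integral_cong_AE)
        show "AE x in lborel. ennreal ((norm (s n x - f x))\<^sup>2) =
            liminf (\<lambda>k. ennreal ((norm (s n x - s (r k) x))\<^sup>2))"
          using lim
        proof eventually_elim
          case (elim x)
          have "(\<lambda>k. ennreal ((norm (s n x - s (r k) x))\<^sup>2)) \<longlonglongrightarrow> ennreal ((norm (s n x - f x))\<^sup>2)"
            by (intro tendsto_ennrealI tendsto_intros elim)
          then show ?case by (intro lim_imp_Liminf[symmetric]) auto
        qed
      qed
      also have "\<dots> \<le> liminf (\<lambda>k. \<integral>\<^sup>+x. ennreal ((norm (s n x - s (r k) x))\<^sup>2) \<partial>lborel)"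
        by (rule nn_integral_liminf) measurable
      also have "\<dots> \<le> liminf (\<lambda>k. ennreal (e\<^sup>2))"
      proof (rule Liminf_mono)
        show "\<forall>\<^sub>F k in sequentially. (\<integral>\<^sup>+x. ennreal ((norm (s n x - s (r k) x))\<^sup>2) \<partial>lborel) \<le> ennreal (e\<^sup>2)"
          using eventually_ge_at_top[of N]
        proof eventually_elim
          case (elim k)
          then have "r k \<ge> N" using strict_mono_imp_increasing[OF r, of k] by linarith
          then have "L2_norm (\<lambda>x. s n x - s (r k) x) < e" using N \<open>n \<ge> N\<close> by blast
          then show ?case by (simp add: nn_integral_L2 L2_diff s power_mono ennreal_leI)
        qed
      qed
      also have "\<dots> = ennreal (e\<^sup>2)" by (intro Liminf_const) simp
      finally show ?thesis .
    qed
    then show ?thesis by blast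
  qed
  have f: "f \<in> L2"
  proof -
    obtain N where "(\<integral>\<^sup>+x. ennreal ((norm (s N x - f x))\<^sup>2) \<partial>lborel) \<le> ennreal (1\<^sup>2)"
      using close[of 1] by auto
    then have "(\<integral>\<^sup>+x. ennreal (norm ((norm (s N x - f x))\<^sup>2)) \<partial>lborel) < \<infinity>"
      by (simp add: le_less_trans)
    then have "(\<lambda>x. s N x - f x) \<in> L2"
      by (intro L2_I integrableI_bounded) auto
    from L2_diff[OF s[of N] this] show ?thesis by simp
  qed
  moreover have "(\<lambda>n. L2_norm (\<lambda>x. s n x - f x)) \<longlonglongrightarrow> 0"
  proof (rule LIMSEQ_I)
    fix e :: real assume e: "e > 0"
    obtain N where N: "\<And>n. n \<ge> N \<Longrightarrow>
        (\<integral>\<^sup>+x. ennreal ((norm (s n x - f x))\<^sup>2) \<partial>lborel) \<le> ennreal ((e/2)\<^sup>2)"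
      using close[of "e/2"] e by auto
    have "L2_norm (\<lambda>x. s n x - f x) < e" if "n \<ge> N" for n
    proof -
      have "ennreal ((L2_norm (\<lambda>x. s n x - f x))\<^sup>2) \<le> ennreal ((e/2)\<^sup>2)"
        using N[OF that] nn_integral_L2[OF L2_diff[OF s f]] by simp
      then have "(L2_norm (\<lambda>x. s n x - f x))\<^sup>2 \<le> (e/2)\<^sup>2"
        by (subst (asm) ennreal_le_iff) simp_all
      then have "L2_norm (\<lambda>x. s n x - f x) \<le> e/2"
        by (rule power2_le_imp_le) (use e in simp)
      then show ?thesis using e by simp
    qed
    then show "\<exists>N. \<forall>n\<ge>N. norm (L2_norm (\<lambda>x. s n x - f x) - 0) < e" by auto
  qed
  ultimately show thesis by (rule that)
qed

section \<open>Closed subspaces and closed linear spans\<close>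

lemma L2_closure_iff:
  "f \<in> L2_closure U \<longleftrightarrow> f \<in> L2 \<and> (\<forall>e>0. \<exists>u\<in>U. L2_norm (\<lambda>x. u x - f x) < e)"
proof (intro iffI conjI allI impI)
  assume "f \<in> L2_closure U"
  then obtain s :: "nat \<Rightarrow> _" where s: "\<And>j. s j \<in> U" "(\<lambda>j. L2_norm (\<lambda>x. s j x - f x)) \<longlonglongrightarrow> 0"
    and f: "f \<in> L2"
    by (auto simp: L2_closure_def)
  show "f \<in> L2" by fact
  fix e :: real assume "e > 0"
  then have "\<forall>\<^sub>F j in sequentially. L2_norm (\<lambda>x. s j x - f x) < e"
    using order_tendstoD(2)[OF s(2)] by blast
  then obtain j where "L2_norm (\<lambda>x. s j x - f x) < e"
    by (auto simp: eventually_sequentially)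
  then show "\<exists>u\<in>U. L2_norm (\<lambda>x. u x - f x) < e" using s(1) by blast
next
  assume *: "f \<in> L2 \<and> (\<forall>e>0. \<exists>u\<in>U. L2_norm (\<lambda>x. u x - f x) < e)"
  have "\<forall>j. \<exists>u\<in>U. L2_norm (\<lambda>x. u x - f x) < inverse (real (Suc j))"
    using * by (auto simp del: of_nat_Suc)
  then obtain s where s: "\<And>j. s j \<in> U" "\<And>j. L2_norm (\<lambda>x. s j x - f x) < inverse (real (Suc j))"
    by metis
  have "(\<lambda>j. L2_norm (\<lambda>x. s j x - f x)) \<longlonglongrightarrow> 0"
    by (rule tendsto_sandwich[OF _ _ tendsto_const LIMSEQ_inverse_real_of_nat])
      (auto intro!: always_eventually less_imp_le[OF s(2)] simp del: of_nat_Suc)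
  then show "f \<in> L2_closure U" using * s(1) by (auto simp: L2_closure_def)
qed

lemma L2_closure_mono: "U \<subseteq> W \<Longrightarrow> L2_closure U \<subseteq> L2_closure W"
  by (fastforce simp: L2_closure_iff)

lemma L2_closure_superset: "U \<subseteq> L2 \<Longrightarrow> U \<subseteq> L2_closure U"
proof
  fix f assume "U \<subseteq> L2" "f \<in> U"
  moreover have "L2_norm (\<lambda>x. f x - f x) = 0" by simp
  ultimately show "f \<in> L2_closure U" unfolding L2_closure_iff by (metis subsetD)
qed

lemma L2_closure_idem:
  assumes "U \<subseteq> L2" shows "L2_closure (L2_closure U) \<subseteq> L2_closure U"
proof
  fix f assume f: "f \<in> L2_closure (L2_closure U)"
  show "f \<in> L2_closure U"
    unfolding L2_closure_iff
  proof (intro conjI allI impI)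
    show f2: "f \<in> L2" using f by (simp add: L2_closure_iff)
    fix e :: real assume "e > 0"
    then obtain g where g: "g \<in> L2_closure U" "L2_norm (\<lambda>x. g x - f x) < e / 2"
      using f half_gt_zero unfolding L2_closure_iff[of f] by blast
    obtain u where u: "u \<in> U" "L2_norm (\<lambda>x. u x - g x) < e / 2"
      using g(1) \<open>e > 0\<close> half_gt_zero unfolding L2_closure_iff[of g] by blast
    have "L2_norm (\<lambda>x. u x - f x) \<le> L2_norm (\<lambda>x. u x - g x) + L2_norm (\<lambda>x. g x - f x)"
      using u(1) assms g(1) f2 by (intro L2_norm_triangle_diff) (auto simp: L2_closure_iff)
    then show "\<exists>u\<in>U. L2_norm (\<lambda>x. u x - f x) < e" using u g by force
  qed
qed

lemma L2_closed_subspace_closure: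
  assumes U: "U \<subseteq> L2" "(\<lambda>x. 0) \<in> U"
    and add: "\<And>f g. f \<in> U \<Longrightarrow> g \<in> U \<Longrightarrow> (\<lambda>x. f x + g x) \<in> U"
    and scale: "\<And>c f. f \<in> U \<Longrightarrow> (\<lambda>x. c * f x) \<in> U"
  shows "L2_closed_subspace (L2_closure U)"
  unfolding L2_closed_subspace_def
proof (intro conjI ballI allI)
  show "L2_closure U \<subseteq> L2" by (auto simp: L2_closure_def)
  show "(\<lambda>x. 0) \<in> L2_closure U" using L2_closure_superset[OF U(1)] U(2) by auto
  show "L2_closure (L2_closure U) \<subseteq> L2_closure U" using U(1) by (rule L2_closure_idem)
next
  fix f g assume fg: "f \<in> L2_closure U" "g \<in> L2_closure U"
  then have L2: "f \<in> L2" "g \<in> L2" by (auto simp: L2_closure_iff)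
  show "(\<lambda>x. f x + g x) \<in> L2_closure U"
    unfolding L2_closure_iff
  proof (intro conjI allI impI)
    show "(\<lambda>x. f x + g x) \<in> L2" using L2 by (rule L2_add)
    fix e :: real assume "e > 0"
    obtain u where u: "u \<in> U" "L2_norm (\<lambda>x. u x - f x) < e / 2"
      using fg(1) half_gt_zero[OF \<open>e > 0\<close>] unfolding L2_closure_iff by blast
    obtain v where v: "v \<in> U" "L2_norm (\<lambda>x. v x - g x) < e / 2"
      using fg(2) half_gt_zero[OF \<open>e > 0\<close>] unfolding L2_closure_iff by blast
    have "L2_norm (\<lambda>x. (u x - f x) + (v x - g x)) \<le> L2_norm (\<lambda>x. u x - f x) + L2_norm (\<lambda>x. v x - g x)"
      using u v L2 U(1) by (intro L2_norm_triangle L2_diff) auto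
    then have "L2_norm (\<lambda>x. (u x + v x) - (f x + g x)) < e"
      using u v by (simp add: algebra_simps)
    then show "\<exists>w\<in>U. L2_norm (\<lambda>x. w x - (f x + g x)) < e"
      using add[OF u(1) v(1)] by (rule bexI[where x = "\<lambda>x. u x + v x"])
  qed
next
  fix c f assume f: "f \<in> L2_closure U"
  show "(\<lambda>x. c * f x) \<in> L2_closure U"
    unfolding L2_closure_iff
  proof (intro conjI allI impI)
    show "(\<lambda>x. c * f x) \<in> L2" using f by (auto simp: L2_closure_iff)
    fix e :: real assume "e > 0"
    then have "e / (norm c + 1) > 0" by (simp add: add_nonneg_pos)
    then obtain u where u: "u \<in> U" "L2_norm (\<lambda>x. u x - f x) < e / (norm c + 1)"
      using f unfolding L2_closure_iff by blast
    have "L2_norm (\<lambda>x. c * u x - c * f x) = norm c * L2_norm (\<lambda>x. u x - f x)"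
      by (simp add: L2_norm_scale flip: right_diff_distrib)
    also have "\<dots> \<le> (norm c + 1) * L2_norm (\<lambda>x. u x - f x)" by (intro mult_right_mono) auto
    also have "\<dots> < e"
      using u(2) by (simp add: pos_less_divide_eq add_nonneg_pos mult.commute)
    finally show "\<exists>w\<in>U. L2_norm (\<lambda>x. w x - c * f x) < e"
      using scale[OF u(1)] by (rule bexI[where x = "\<lambda>x. c * u x"])
  qed
qed

lemma closed_subspaceD:
  assumes "L2_closed_subspace T"
  shows "T \<subseteq> L2" "(\<lambda>x. 0) \<in> T" "L2_closure T \<subseteq> T"
    and "f \<in> T \<Longrightarrow> g \<in> T \<Longrightarrow> (\<lambda>x. f x + g x) \<in> T"
    and "f \<in> T \<Longrightarrow> (\<lambda>x. c * f x) \<in> T"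
  using assms by (simp_all add: L2_closed_subspace_def)

lemma closed_subspace_diff:
  assumes "L2_closed_subspace T" "f \<in> T" "g \<in> T" shows "(\<lambda>x. f x - g x) \<in> T"
  using closed_subspaceD(4)[OF assms(1,2) closed_subspaceD(5)[OF assms(1,3), of "-1"]] by simp

lemma closed_subspace_sum:
  assumes "L2_closed_subspace T" "\<And>i. i \<in> F \<Longrightarrow> u i \<in> T"
  shows "(\<lambda>x. \<Sum>i\<in>F. u i x) \<in> T"
  using assms(2)
proof (induction F rule: infinite_finite_induct)
  case (insert i F)
  then have "(\<lambda>x. u i x + (\<Sum>i\<in>F. u i x)) \<in> T"
    by (intro closed_subspaceD(4)[OF assms(1)]) auto
  then show ?case using insert by simp
qed (use assms(1) in \<open>auto simp: L2_closed_subspace_def\<close>)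

text \<open>
  The closed linear span of an indexed family. As the closure consists of functions, it contains with
  a function all its square-integrable almost everywhere modifications.
\<close>

abbreviation closed_span :: "('i \<Rightarrow> real \<Rightarrow> complex) \<Rightarrow> (real \<Rightarrow> complex) set" where
  "closed_span e \<equiv> L2_closure (complex_span (range e))"

lemma complex_span_subset: "(\<And>i. e i \<in> L2) \<Longrightarrow> complex_span (range e) \<subseteq> L2"
  by (force simp: complex_span_def)

lemma closed_subspace_closed_span:
  assumes "\<And>i. e i \<in> L2" shows "L2_closed_subspace (closed_span e)"
proof (rule L2_closed_subspace_closure)
  show "complex_span (range e) \<subseteq> L2" using assms by (rule complex_span_subset)
  show "(\<lambda>x. 0) \<in> complex_span (range e)"
    unfolding complex_span_def by (auto intro!: exI[of _ "{}"])
next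
  fix f g assume "f \<in> complex_span (range e)" "g \<in> complex_span (range e)"
  then obtain F c G d where
    F: "finite F" "F \<subseteq> range e" "f = (\<lambda>x. \<Sum>u\<in>F. c u * u x)" and
    G: "finite G" "G \<subseteq> range e" "g = (\<lambda>x. \<Sum>u\<in>G. d u * u x)"
    unfolding complex_span_def by blast
  have "(\<Sum>u\<in>F. c u * u x) = (\<Sum>u\<in>F \<union> G. (if u \<in> F then c u else 0) * u x)" for x
    using F(1) G(1) by (intro sum.mono_neutral_cong_left) auto
  moreover have "(\<Sum>u\<in>G. d u * u x) = (\<Sum>u\<in>F \<union> G. (if u \<in> G then d u else 0) * u x)" for x
    using F(1) G(1) by (intro sum.mono_neutral_cong_left) auto
  ultimately have "(\<lambda>x. f x + g x) =
      (\<lambda>x. \<Sum>u\<in>F \<union> G. ((if u \<in> F then c u else 0) + (if u \<in> G then d u else 0)) * u x)"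
    unfolding F(3) G(3) by (simp add: ring_distribs sum.distrib)
  then show "(\<lambda>x. f x + g x) \<in> complex_span (range e)"
    unfolding complex_span_def using F(1,2) G(1,2)
    by (intro CollectI exI[of _ "F \<union> G"]
        exI[of _ "\<lambda>u. (if u \<in> F then c u else 0) + (if u \<in> G then d u else 0)"]) auto
next
  fix a f assume "f \<in> complex_span (range e)"
  then obtain F c where F: "finite F" "F \<subseteq> range e" "f = (\<lambda>x. \<Sum>u\<in>F. c u * u x)"
    unfolding complex_span_def by blast
  then show "(\<lambda>x. a * f x) \<in> complex_span (range e)"
    unfolding complex_span_def
    by (intro CollectI exI[of _ F] exI[of _ "\<lambda>u. a * c u"]) (auto simp: sum_distrib_left mult.assoc)
qed

lemma closed_span_base:
  assumes e: "\<And>i. e i \<in> L2" shows "e i \<in> closed_span e"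
proof -
  have "e i \<in> complex_span (range e)"
    unfolding complex_span_def by (intro CollectI exI[of _ "{e i}"] exI[of _ "\<lambda>_. 1"]) auto
  then show ?thesis using L2_closure_superset[OF complex_span_subset, of e] e by blast
qed

lemma closed_span_minimal:
  assumes T: "L2_closed_subspace T" and e: "\<And>i. e i \<in> T"
  shows "closed_span e \<subseteq> T"
proof -
  have "(\<lambda>x. \<Sum>u\<in>F. c u * u x) \<in> T" if "F \<subseteq> range e" for F c
  proof (rule closed_subspace_sum[OF T])
    fix u assume "u \<in> F"
    then have "u \<in> T" using that e by blast
    then show "(\<lambda>x. c u * u x) \<in> T" by (rule closed_subspaceD(5)[OF T])
  qed
  then have "complex_span (range e) \<subseteq> T" by (auto simp: complex_span_def)
  then have "closed_span e \<subseteq> L2_closure T" by (rule L2_closure_mono)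
  then show ?thesis using T by (auto simp: L2_closed_subspace_def)
qed

section \<open>Orthonormal families\<close>

text \<open>Orthonormality of an indexed family, without any claim about its span.\<close>

definition L2_orthonormal :: "('i \<Rightarrow> real \<Rightarrow> complex) \<Rightarrow> bool" where
  "L2_orthonormal e \<longleftrightarrow>
     (\<forall>i. e i \<in> L2) \<and> (\<forall>i j. L2_inner (e i) (e j) = (if i = j then 1 else 0))"

lemma L2_orthonormalD:
  assumes "L2_orthonormal e"
  shows "e i \<in> L2" "L2_inner (e i) (e j) = (if i = j then 1 else 0)"
  using assms by (auto simp: L2_orthonormal_def)

lemma L2_orthonormal_basis_iff:
  "L2_orthonormal_basis e V \<longleftrightarrow> L2_orthonormal e \<and> closed_span e = V"
  by (auto simp: L2_orthonormal_basis_def L2_orthonormal_def)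

lemma closed_span_subset_L2: "closed_span e \<subseteq> L2"
  by (auto simp: L2_closure_def)

lemma closed_span_L2: "f \<in> closed_span e \<Longrightarrow> f \<in> L2"
  by (auto simp: L2_closure_def)

lemma complex_span_orthonormal:
  assumes "L2_orthonormal e"
  shows "complex_span (range e) = {\<lambda>x. \<Sum>i\<in>F. c i * e i x | F c. finite F}" (is "_ = ?R")
proof -
  have inj: "inj e"
    by (rule injI) (metis L2_orthonormalD(2)[OF assms] zero_neq_one)
  show ?thesis
  proof (intro equalityI subsetI)
    fix f assume "f \<in> complex_span (range e)"
    then obtain F c where F: "finite F" "F \<subseteq> range e" "f = (\<lambda>x. \<Sum>u\<in>F. c u * u x)"
      unfolding complex_span_def by blast
    obtain G where G: "finite G" "F = e ` G" using finite_subset_image[OF F(1,2)] by blast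
    have "f = (\<lambda>x. \<Sum>i\<in>G. c (e i) * e i x)"
      unfolding F(3) G(2) using inj by (simp add: sum.reindex inj_on_subset)
    then show "f \<in> ?R" using G(1) by (intro CollectI exI[of _ G] exI[of _ "c \<circ> e"]) auto
  next
    fix f assume "f \<in> ?R"
    then obtain F c where F: "finite F" "f = (\<lambda>x. \<Sum>i\<in>F. c i * e i x)" by blast
    have "f = (\<lambda>x. \<Sum>u\<in>e ` F. c (inv e u) * u x)"
      unfolding F(2) using inj by (simp add: sum.reindex inj_on_subset inv_f_f)
    then show "f \<in> complex_span (range e)"
      unfolding complex_span_def using F(1)
      by (intro CollectI exI[of _ "e ` F"] exI[of _ "c \<circ> inv e"]) auto
  qed
qed

lemma norm_diff_square_complex: "(norm (c - z))\<^sup>2 = (norm c)\<^sup>2 - 2 * Re (c * cnj z) + (norm z)\<^sup>2"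
  unfolding cmod_power2 by (simp add: power2_eq_square algebra_simps)

lemma inner_orthonormal_sum:
  assumes "L2_orthonormal e" "finite F"
  shows "L2_inner (\<lambda>x. \<Sum>i\<in>F. c i * e i x) (e j) = (if j \<in> F then c j else 0)"
  using assms(2) L2_orthonormalD(1)[OF assms(1)]
  by (subst L2_inner_sum_left)
    (auto simp: L2_inner_scale_left L2_orthonormalD(2)[OF assms(1)] if_distrib cong: if_cong)

lemma norm_orthonormal_sum:
  assumes "L2_orthonormal e" "finite F"
  shows "(L2_norm (\<lambda>x. \<Sum>i\<in>F. c i * e i x))\<^sup>2 = (\<Sum>i\<in>F. (norm (c i))\<^sup>2)"
proof -
  have "L2_inner (\<lambda>x. \<Sum>i\<in>F. c i * e i x) (\<lambda>x. \<Sum>i\<in>F. c i * e i x) =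
      (\<Sum>j\<in>F. cnj (c j) * L2_inner (\<lambda>x. \<Sum>i\<in>F. c i * e i x) (e j))"
    using L2_orthonormalD(1)[OF assms(1)]
    by (subst L2_inner_sum_right) (auto simp: L2_inner_scale_right intro!: L2_sum L2_scale)
  also have "\<dots> = of_real (\<Sum>i\<in>F. (norm (c i))\<^sup>2)"
    unfolding inner_orthonormal_sum[OF assms] of_real_sum
    by (intro sum.cong) (simp_all add: complex_norm_square[unfolded of_real_power])
  finally show ?thesis unfolding L2_inner_self of_real_eq_iff .
qed

text \<open>
  The distance from \<open>f\<close> to a finite combination of an orthonormal family splits into the distance to
  the best one and the deviation of the coefficients. Bessel's inequality and the best approximation
  property are immediate consequences.
\<close>

lemma orthonormal_dist_square:
  assumes e: "L2_orthonormal e" and F: "finite F" and f: "f \<in> L2"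
  shows "(L2_norm (\<lambda>x. (\<Sum>i\<in>F. c i * e i x) - f x))\<^sup>2 =
    (L2_norm f)\<^sup>2 - (\<Sum>i\<in>F. (norm (L2_inner f (e i)))\<^sup>2) + (\<Sum>i\<in>F. (norm (c i - L2_inner f (e i)))\<^sup>2)"
proof -
  have "L2_inner (\<lambda>x. \<Sum>i\<in>F. c i * e i x) f = (\<Sum>i\<in>F. c i * cnj (L2_inner f (e i)))"
    using f L2_orthonormalD(1)[OF e]
    by (subst L2_inner_sum_left) (auto simp: L2_inner_scale_left simp flip: L2_inner_commute)
  then show ?thesis
    using f L2_orthonormalD(1)[OF e]
    by (subst L2_norm_diff_square)
      (auto intro!: L2_sum L2_scale simp: norm_orthonormal_sum[OF e F] norm_diff_square_complex sum.distrib sum_subtractf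
        simp flip: sum_distrib_left)
qed

lemma Bessel_finite:
  assumes "L2_orthonormal e" "finite F" "f \<in> L2"
  shows "(\<Sum>i\<in>F. (norm (L2_inner f (e i)))\<^sup>2) \<le> (L2_norm f)\<^sup>2"
  using orthonormal_dist_square[OF assms, of "\<lambda>i. L2_inner f (e i)"]
    zero_le_power2[of "L2_norm (\<lambda>x. (\<Sum>i\<in>F. L2_inner f (e i) * e i x) - f x)"]
  by simp

lemma Bessel_summable:
  assumes "L2_orthonormal e" "f \<in> L2"
  shows "(\<lambda>i. (norm (L2_inner f (e i)))\<^sup>2) summable_on UNIV"
  by (rule nonneg_bdd_above_summable_on)
    (auto intro!: bdd_aboveI[of _ "(L2_norm f)\<^sup>2"] Bessel_finite assms)

text \<open>
  Membership in the closed span, convergence of the expansion, and equality in Bessel's inequality are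
  equivalent. The last condition turns membership into a statement about a numerical series.
\<close>

lemma closed_span_imp_has_sum:
  assumes e: "L2_orthonormal e" and f: "f \<in> closed_span e"
  shows "((\<lambda>i. (norm (L2_inner f (e i)))\<^sup>2) has_sum (L2_norm f)\<^sup>2) UNIV"
  unfolding has_sum_def tendsto_iff eventually_finite_subsets_at_top
proof (intro allI impI)
  fix \<epsilon> :: real assume "\<epsilon> > 0"
  have f2: "f \<in> L2" using f by (rule closed_span_L2)
  have "\<exists>u\<in>complex_span (range e). L2_norm (\<lambda>x. u x - f x) < sqrt \<epsilon>"
    using f \<open>\<epsilon> > 0\<close> unfolding L2_closure_iff by simp
  then obtain G c where G: "finite G" "L2_norm (\<lambda>x. (\<Sum>i\<in>G. c i * e i x) - f x) < sqrt \<epsilon>"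
    unfolding complex_span_orthonormal[OF e] by blast
  have "(L2_norm (\<lambda>x. (\<Sum>i\<in>G. c i * e i x) - f x))\<^sup>2 < (sqrt \<epsilon>)\<^sup>2"
    using G(2) by (intro power_strict_mono) auto
  moreover have "0 \<le> (\<Sum>i\<in>G. (norm (c i - L2_inner f (e i)))\<^sup>2)" by (intro sum_nonneg) auto
  ultimately have *: "(L2_norm f)\<^sup>2 - (\<Sum>i\<in>G. (norm (L2_inner f (e i)))\<^sup>2) < \<epsilon>"
    using orthonormal_dist_square[OF e G(1) f2, of c] \<open>\<epsilon> > 0\<close> by simp
  have "dist (\<Sum>i\<in>F. (norm (L2_inner f (e i)))\<^sup>2) ((L2_norm f)\<^sup>2) < \<epsilon>"
    if "finite F" "G \<subseteq> F" for F
  proof -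
    have "(\<Sum>i\<in>G. (norm (L2_inner f (e i)))\<^sup>2) \<le> (\<Sum>i\<in>F. (norm (L2_inner f (e i)))\<^sup>2)"
      using that by (intro sum_mono2) auto
    then show ?thesis using * Bessel_finite[OF e that(1) f2] by (simp add: dist_real_def)
  qed
  then show "\<exists>X. finite X \<and> X \<subseteq> UNIV \<and> (\<forall>Y. finite Y \<and> X \<subseteq> Y \<and> Y \<subseteq> UNIV \<longrightarrow>
      dist (\<Sum>i\<in>Y. (norm (L2_inner f (e i)))\<^sup>2) ((L2_norm f)\<^sup>2) < \<epsilon>)"
    using G(1) by blast
qed

lemma has_sum_imp_L2_has_sum:
  assumes e: "L2_orthonormal e" and f: "f \<in> L2"
    and hs: "((\<lambda>i. (norm (L2_inner f (e i)))\<^sup>2) has_sum (L2_norm f)\<^sup>2) UNIV"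
  shows "L2_has_sum (\<lambda>i x. L2_inner f (e i) * e i x) f"
  unfolding L2_has_sum_def
proof (intro conjI allI)
  show "(\<lambda>x. L2_inner f (e i) * e i x) \<in> L2" for i using L2_orthonormalD(1)[OF e] by auto
  have "((\<lambda>F. sqrt ((L2_norm f)\<^sup>2 - (\<Sum>i\<in>F. (norm (L2_inner f (e i)))\<^sup>2))) \<longlongrightarrow>
      sqrt ((L2_norm f)\<^sup>2 - (L2_norm f)\<^sup>2)) (finite_subsets_at_top UNIV)"
    using hs unfolding has_sum_def by (intro tendsto_intros)
  moreover have "\<forall>\<^sub>F F in finite_subsets_at_top UNIV.
      sqrt ((L2_norm f)\<^sup>2 - (\<Sum>i\<in>F. (norm (L2_inner f (e i)))\<^sup>2)) =
      L2_norm (\<lambda>x. (\<Sum>i\<in>F. L2_inner f (e i) * e i x) - f x)"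
  proof (rule eventually_finite_subsets_at_top_weakI)
    fix F :: "'a set" assume "finite F"
    show "sqrt ((L2_norm f)\<^sup>2 - (\<Sum>i\<in>F. (norm (L2_inner f (e i)))\<^sup>2)) =
        L2_norm (\<lambda>x. (\<Sum>i\<in>F. L2_inner f (e i) * e i x) - f x)"
      using orthonormal_dist_square[OF e \<open>finite F\<close> f, of "\<lambda>i. L2_inner f (e i)"]
      by (intro real_sqrt_unique) auto
  qed
  ultimately show "((\<lambda>F. L2_norm (\<lambda>x. (\<Sum>i\<in>F. L2_inner f (e i) * e i x) - f x)) \<longlongrightarrow> 0)
      (finite_subsets_at_top UNIV)"
    by (simp add: tendsto_cong)
qed fact

lemma L2_has_sum_imp_closed_span:
  assumes e: "L2_orthonormal e" and hs: "L2_has_sum (\<lambda>i x. c i * e i x) f"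
  shows "f \<in> closed_span e"
  unfolding L2_closure_iff
proof (intro conjI allI impI)
  show "f \<in> L2" using hs by (simp add: L2_has_sum_def)
  fix \<epsilon> :: real assume "\<epsilon> > 0"
  have "((\<lambda>F. L2_norm (\<lambda>x. (\<Sum>i\<in>F. c i * e i x) - f x)) \<longlongrightarrow> 0) (finite_subsets_at_top UNIV)"
    using hs by (simp add: L2_has_sum_def)
  then have "\<forall>\<^sub>F F in finite_subsets_at_top UNIV. L2_norm (\<lambda>x. (\<Sum>i\<in>F. c i * e i x) - f x) < \<epsilon>"
    using \<open>\<epsilon> > 0\<close> by (rule order_tendstoD)
  then obtain F where "finite F" "L2_norm (\<lambda>x. (\<Sum>i\<in>F. c i * e i x) - f x) < \<epsilon>"
    by (auto simp: eventually_finite_subsets_at_top)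
  then show "\<exists>u\<in>complex_span (range e). L2_norm (\<lambda>x. u x - f x) < \<epsilon>"
    unfolding complex_span_orthonormal[OF e]
    by (intro bexI[where x = "\<lambda>x. \<Sum>i\<in>F. c i * e i x"] CollectI exI[of _ F] exI[of _ c]) auto
qed

lemma closed_span_iff_has_sum:
  assumes "L2_orthonormal e"
  shows "f \<in> closed_span e \<longleftrightarrow>
    f \<in> L2 \<and> ((\<lambda>i. (norm (L2_inner f (e i)))\<^sup>2) has_sum (L2_norm f)\<^sup>2) UNIV"
  using closed_span_imp_has_sum[OF assms, of f] closed_span_L2[of f e]
    L2_has_sum_imp_closed_span[OF assms has_sum_imp_L2_has_sum[OF assms, of f]] by blast

lemma inner_tendsto_left:
  assumes "((\<lambda>n. L2_norm (\<lambda>x. s n x - f x)) \<longlongrightarrow> 0) \<F>" "\<And>n. s n \<in> L2" "f \<in> L2" "h \<in> L2"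
  shows "((\<lambda>n. L2_inner (s n) h) \<longlongrightarrow> L2_inner f h) \<F>"
proof (rule Lim_transform2[OF tendsto_const])
  have "((\<lambda>n. L2_inner f h - L2_inner (s n) h) \<longlongrightarrow> 0) \<F>"
  proof (rule Lim_null_comparison[OF always_eventually])
    show "\<forall>n. norm (L2_inner f h - L2_inner (s n) h) \<le> L2_norm (\<lambda>x. s n x - f x) * L2_norm h"
    proof
      fix n
      have "norm (L2_inner f h - L2_inner (s n) h) = norm (L2_inner (\<lambda>x. s n x - f x) h)"
        using assms by (simp add: L2_inner_diff_left norm_minus_commute)
      also have "\<dots> \<le> L2_norm (\<lambda>x. s n x - f x) * L2_norm h"
        using assms by (intro L2_Cauchy_Schwarz) auto
      finally show "norm (L2_inner f h - L2_inner (s n) h) \<le> \<dots>" .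
    qed
    show "((\<lambda>n. L2_norm (\<lambda>x. s n x - f x) * L2_norm h) \<longlongrightarrow> 0) \<F>"
      using tendsto_mult_right[OF assms(1), of "L2_norm h"] by simp
  qed
  then show "((\<lambda>n. L2_inner f h - L2_inner (s n) h) \<longlongrightarrow> 0) \<F>" .
qed

lemma Parseval:
  assumes e: "L2_orthonormal e" and f: "f \<in> closed_span e" and h: "h \<in> L2"
  shows "((\<lambda>i. L2_inner f (e i) * cnj (L2_inner h (e i))) has_sum L2_inner f h) UNIV"
proof -
  note eL = L2_orthonormalD(1)[OF e]
  have f2: "f \<in> L2" using f by (rule closed_span_L2)
  have hs: "L2_has_sum (\<lambda>i x. L2_inner f (e i) * e i x) f"
    using has_sum_imp_L2_has_sum[OF e f2 closed_span_imp_has_sum[OF e f]] .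
  have "((\<lambda>F. L2_inner (\<lambda>x. \<Sum>i\<in>F. L2_inner f (e i) * e i x) h) \<longlongrightarrow> L2_inner f h)
      (finite_subsets_at_top UNIV)"
    using hs eL by (intro inner_tendsto_left f2 h L2_sum L2_scale) (auto simp: L2_has_sum_def)
  also have "(\<lambda>F. L2_inner (\<lambda>x. \<Sum>i\<in>F. L2_inner f (e i) * e i x) h) =
      (\<lambda>F. \<Sum>i\<in>F. L2_inner f (e i) * cnj (L2_inner h (e i)))"
    using h eL by (subst L2_inner_sum_left)
      (auto simp: L2_inner_scale_left simp flip: L2_inner_commute)
  finally show ?thesis unfolding has_sum_def .
qed

lemma closed_span_inner_eq:
  assumes e: "L2_orthonormal e" and f: "f \<in> closed_span e" and "g \<in> L2" "h \<in> L2"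
    and "\<And>i. L2_inner g (e i) = L2_inner h (e i)"
  shows "L2_inner g f = L2_inner h f"
proof -
  have "L2_inner f g = L2_inner f h"
    using Parseval[OF e f \<open>g \<in> L2\<close>] Parseval[OF e f \<open>h \<in> L2\<close>] assms(5) has_sum_unique by fastforce
  then show ?thesis using L2_inner_commute by metis
qed

lemma L2_convergent_if_dist_square:
  fixes a :: "nat \<Rightarrow> real"
  assumes s: "\<And>n. s n \<in> L2" and a: "convergent a"
    and dist: "\<And>m n. m \<le> n \<Longrightarrow> (L2_norm (\<lambda>x. s n x - s m x))\<^sup>2 = \<bar>a n - a m\<bar>"
  obtains f where "f \<in> L2" "(\<lambda>n. L2_norm (\<lambda>x. s n x - f x)) \<longlonglongrightarrow> 0"
proof (rule L2_complete[OF s])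
  fix \<epsilon> :: real assume "\<epsilon> > 0"
  obtain N where N: "\<And>m n. m \<ge> N \<Longrightarrow> n \<ge> N \<Longrightarrow> \<bar>a m - a n\<bar> < \<epsilon>\<^sup>2"
    using CauchyD[OF convergent_Cauchy[OF a], of "\<epsilon>\<^sup>2"] \<open>\<epsilon> > 0\<close> by auto
  have *: "(L2_norm (\<lambda>x. s m x - s n x))\<^sup>2 = \<bar>a m - a n\<bar>" for m n
  proof (cases "n \<le> m")
    case True
    then show ?thesis by (rule dist)
  next
    case False
    then show ?thesis
      using dist[of m n] by (simp add: L2_norm_minus_commute[of "s m"] abs_minus_commute[of "a m"])
  qed
  have "L2_norm (\<lambda>x. s m x - s n x) < \<epsilon>" if "m \<ge> N" "n \<ge> N" for m n
  proof (rule power2_less_imp_less)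
    show "(L2_norm (\<lambda>x. s m x - s n x))\<^sup>2 < \<epsilon>\<^sup>2" using N[OF that] by (simp only: *)
  qed (use \<open>\<epsilon> > 0\<close> in simp)
  then show "\<exists>N. \<forall>m\<ge>N. \<forall>n\<ge>N. L2_norm (\<lambda>x. s m x - s n x) < \<epsilon>" by blast
qed (rule that)

lemma ex_coefficients:
  fixes e :: "'i::countable \<Rightarrow> real \<Rightarrow> complex"
  assumes e: "L2_orthonormal e" and c: "(\<lambda>i. (norm (c i))\<^sup>2) summable_on UNIV"
  obtains f where "f \<in> closed_span e" "\<And>i. L2_inner f (e i) = c i"
proof -
  note eL = L2_orthonormalD(1)[OF e]
  \<comment> \<open>An exhaustion of the index type by finite sets.\<close>
  define G where "G n = {i::'i. to_nat i < n}" for n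
  define s where "s n = (\<lambda>x. \<Sum>i\<in>G n. c i * e i x)" for n
  define a where "a n = (\<Sum>i\<in>G n. (norm (c i))\<^sup>2)" for n
  have fin [simp]: "finite (G n)" for n
  proof (rule finite_imageD)
    show "finite (to_nat ` G n)" by (rule finite_subset[of _ "{..<n}"]) (auto simp: G_def)
    show "inj_on to_nat (G n)" by (simp add: inj_on_def)
  qed
  have mono: "G m \<subseteq> G n" if "m \<le> n" for m n using that by (auto simp: G_def)
  have sL: "s n \<in> L2" for n unfolding s_def by (intro L2_sum L2_scale eL)
  have diff: "(L2_norm (\<lambda>x. s n x - s m x))\<^sup>2 = \<bar>a n - a m\<bar>" if "m \<le> n" for m n
  proof -
    have "(\<lambda>x. s n x - s m x) = (\<lambda>x. \<Sum>i\<in>G n - G m. c i * e i x)"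
      unfolding s_def using mono[OF that] by (simp add: sum_diff)
    then show ?thesis
      using norm_orthonormal_sum[OF e, of "G n - G m" c] mono[OF that]
      by (simp add: a_def sum_diff sum_mono2)
  qed
  have "a n \<le> (\<Sum>\<^sub>\<infinity>i. (norm (c i))\<^sup>2)" for n
    unfolding a_def by (rule finite_sum_le_infsum[OF c]) auto
  moreover have "incseq a"
    unfolding a_def by (intro incseq_SucI sum_mono2 mono) auto
  ultimately have "convergent a" by (meson incseq_convergent convergentI)
  then obtain f where f: "f \<in> L2" "(\<lambda>n. L2_norm (\<lambda>x. s n x - f x)) \<longlonglongrightarrow> 0"
    using diff by (rule L2_convergent_if_dist_square[OF sL])
  have "s n \<in> complex_span (range e)" for n
    unfolding complex_span_orthonormal[OF e] s_def using fin by blast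
  then have "f \<in> closed_span e" using f by (auto simp: L2_closure_def)
  moreover have "L2_inner f (e i) = c i" for i
  proof (rule LIMSEQ_unique)
    show "(\<lambda>n. L2_inner (s n) (e i)) \<longlonglongrightarrow> L2_inner f (e i)"
      using f eL sL by (intro inner_tendsto_left) auto
    have "\<forall>\<^sub>F n in sequentially. L2_inner (s n) (e i) = c i"
      using eventually_gt_at_top[of "to_nat i"]
      by eventually_elim (simp add: s_def inner_orthonormal_sum[OF e fin], simp add: G_def)
    then show "(\<lambda>n. L2_inner (s n) (e i)) \<longlonglongrightarrow> c i" by (rule tendsto_eventually)
  qed
  ultimately show thesis by (rule that)
qed

text \<open>
  The orthogonal projection onto the closed span, characterised by its inner products; its value is
  only determined up to a null set, hence the choice of one representative.
\<close>

definition proj :: "('i::countable \<Rightarrow> real \<Rightarrow> complex) \<Rightarrow> (real \<Rightarrow> complex) \<Rightarrow> real \<Rightarrow> complex" where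
  "proj e f = (SOME g. g \<in> closed_span e \<and> (\<forall>i. L2_inner g (e i) = L2_inner f (e i)))"

lemma proj:
  assumes "L2_orthonormal e" "f \<in> L2"
  shows proj_closed_span: "proj e f \<in> closed_span e"
    and proj_inner: "L2_inner (proj e f) (e i) = L2_inner f (e i)"
proof -
  have "\<exists>g. g \<in> closed_span e \<and> (\<forall>i. L2_inner g (e i) = L2_inner f (e i))"
    by (rule ex_coefficients[OF assms(1) Bessel_summable[OF assms]]) blast
  from someI_ex[OF this] show "proj e f \<in> closed_span e" "L2_inner (proj e f) (e i) = L2_inner f (e i)"
    unfolding proj_def by auto
qed

lemma proj_inner_closed_span:
  assumes e: "L2_orthonormal e" and f: "f \<in> L2" and v: "v \<in> closed_span e"
  shows "L2_inner (proj e f) v = L2_inner f v"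
  by (rule closed_span_inner_eq[OF e v closed_span_L2[OF proj_closed_span[OF e f]] f proj_inner[OF e f]])

lemma proj_best_approximation:
  assumes e: "L2_orthonormal e" and f: "f \<in> L2" and v: "v \<in> closed_span e"
  shows "L2_norm (\<lambda>x. proj e f x - f x) \<le> L2_norm (\<lambda>x. v x - f x)"
proof -
  let ?g = "proj e f"
  have g: "?g \<in> closed_span e" "?g \<in> L2" and v2: "v \<in> L2"
    using proj_closed_span[OF e f] v by (auto dest: closed_span_L2)
  have d: "(\<lambda>x. v x - ?g x) \<in> closed_span e"
    using closed_subspace_diff[OF closed_subspace_closed_span v g(1)] L2_orthonormalD(1)[OF e] by blast
  have "L2_inner (\<lambda>x. f x - ?g x) (\<lambda>x. v x - ?g x) = 0"
    using proj_inner_closed_span[OF e f d] f g closed_span_L2[OF d] by (simp add: L2_inner_diff_left)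
  then have "(L2_norm (\<lambda>x. (f x - ?g x) - (v x - ?g x)))\<^sup>2 =
      (L2_norm (\<lambda>x. f x - ?g x))\<^sup>2 + (L2_norm (\<lambda>x. v x - ?g x))\<^sup>2"
    using f g v2 by (subst L2_norm_diff_square) auto
  then have "(L2_norm (\<lambda>x. f x - ?g x))\<^sup>2 \<le> (L2_norm (\<lambda>x. f x - v x))\<^sup>2"
    by simp
  then show ?thesis
    by (simp add: L2_norm_minus_commute[of f] power_mono_iff)
qed

section \<open>Dilated and translated atoms\<close>

lemma L2_affine:
  assumes "f \<in> L2" "c > 0" shows "(\<lambda>x. f (c * x - t)) \<in> L2"
proof (rule L2_I)
  have [measurable]: "f \<in> borel_measurable borel" using assms(1) by (rule L2_measurable)
  show "(\<lambda>x. f (c * x - t)) \<in> borel_measurable borel" by measurable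
  show "integrable lborel (\<lambda>x. (norm (f (c * x - t)))\<^sup>2)"
    using lborel_integrable_real_affine[OF L2_integrable[OF assms(1)], of c "-t"] assms(2) by simp
qed

lemma inner_affine:
  assumes "c > 0"
  shows "L2_inner (\<lambda>x. f (c * x - t)) (\<lambda>x. g (c * x - t)) = L2_inner f g / of_real c"
  using lborel_integral_real_affine[of c "\<lambda>x. f x * cnj (g x)" "-t"] assms
  by (simp add: L2_inner_def scaleR_conv_of_real)

lemma norm_affine_square:
  assumes "c > 0" shows "(L2_norm (\<lambda>x. f (c * x - t)))\<^sup>2 = (L2_norm f)\<^sup>2 / c"
proof -
  have "of_real ((L2_norm (\<lambda>x. f (c * x - t)))\<^sup>2) = complex_of_real ((L2_norm f)\<^sup>2 / c)"
    unfolding of_real_divide L2_inner_self[symmetric] by (rule inner_affine[OF assms])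
  then show ?thesis unfolding of_real_eq_iff .
qed

text \<open>The unitarily normalised dilate of \<open>g\<close> at scale \<open>2\<^sup>k\<close>, translated by \<open>n / 2\<^sup>k\<close>.\<close>

definition atom :: "int \<Rightarrow> int \<Rightarrow> (real \<Rightarrow> complex) \<Rightarrow> real \<Rightarrow> complex" where
  "atom k n g x = of_real (2 powr (of_int k / 2)) * g (2 powi k * x - of_int n)"

lemma atom_0_0 [simp]: "atom 0 0 g = g"
  by (simp add: atom_def fun_eq_iff)

lemma atom_L2 [simp]: "g \<in> L2 \<Longrightarrow> atom k n g \<in> L2"
  unfolding atom_def by (intro L2_scale L2_affine) auto

lemma powr_half_square: "(2 powr (of_int k / 2))\<^sup>2 = (2::real) powi k"
  by (simp add: power2_eq_square powr_real_of_int' flip: powr_add)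

text \<open>
  Substituting \<open>2\<^sup>k x - n\<close> for \<open>x\<close>: an inner product of atoms at scales \<open>k\<close> and \<open>k + l\<close> depends on
  the difference \<open>l\<close> of the scales and on the relative position of the atoms only.
\<close>

lemma inner_atom:
  "L2_inner (atom k n f) (atom (k + int l) j g) = L2_inner f (atom (int l) (j - 2 ^ l * n) g)"
proof -
  let ?c = "2 powi k :: real"
  have sub: "2 powi (k + int l) * x - of_int j = 2 ^ l * (?c * x - of_int n) - of_int (j - 2 ^ l * n)"
    for x :: real
    by (simp add: power_int_add algebra_simps)
  have const: "2 powr (of_int (k + int l) / 2) = 2 powr (of_int k / 2) * 2 powr (of_int (int l) / (2::real))"
    by (simp add: add_divide_distrib powr_add)
  have "atom (k + int l) j g =
      (\<lambda>x. of_real (2 powr (of_int k / 2)) * atom (int l) (j - 2 ^ l * n) g (?c * x - of_int n))"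
    unfolding atom_def sub const by (simp add: mult.assoc fun_eq_iff)
  moreover have "atom k n f = (\<lambda>x. of_real (2 powr (of_int k / 2)) * f (?c * x - of_int n))"
    by (simp add: atom_def fun_eq_iff)
  ultimately have "L2_inner (atom k n f) (atom (k + int l) j g) =
      of_real ((2 powr (of_int k / 2))\<^sup>2) * (L2_inner f (atom (int l) (j - 2 ^ l * n) g) / of_real ?c)"
    by (simp add: L2_inner_scale_left L2_inner_scale_right inner_affine power2_eq_square)
  then show ?thesis unfolding powr_half_square by simp
qed

lemma inner_atom_same: "L2_inner (atom k n f) (atom k m g) = L2_inner f (atom 0 (m - n) g)"
  using inner_atom[of k n f 0 m g] by simp

lemma inner_atom_next: "L2_inner (atom k n f) (atom (k + 1) j g) = L2_inner f (atom 1 (j - 2 * n) g)"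
  using inner_atom[of k n f 1 j g] by simp

lemma norm_atom: "L2_norm (atom k n g) = L2_norm g"
proof -
  have "complex_of_real ((L2_norm (atom k n g))\<^sup>2) = of_real ((L2_norm g)\<^sup>2)"
    unfolding L2_inner_self[symmetric] inner_atom_same by simp
  then show ?thesis unfolding of_real_eq_iff by (simp add: power2_eq_iff_nonneg)
qed

lemma L2_orthonormal_atoms:
  assumes "L2_orthonormal (\<lambda>n. atom 0 n g)"
  shows "L2_orthonormal (\<lambda>n. atom k n g)"
  unfolding L2_orthonormal_def
proof (intro conjI allI)
  have "g \<in> L2" using L2_orthonormalD(1)[OF assms, of 0] by simp
  then show "atom k n g \<in> L2" for n by simp
  show "L2_inner (atom k n g) (atom k m g) = (if n = m then 1 else 0)" for n m
    using L2_orthonormalD(2)[OF assms, of n m] by (simp add: inner_atom_same)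
qed

lemma closed_span_atom_dilate:
  assumes on: "L2_orthonormal (\<lambda>n. atom 0 n g)" and f: "f \<in> L2"
  shows "(\<lambda>x. f (2 * x)) \<in> closed_span (\<lambda>n. atom (k + 1) n g) \<longleftrightarrow> f \<in> closed_span (\<lambda>n. atom k n g)"
proof -
  have inner: "L2_inner (\<lambda>x. f (2 * x)) (atom (k + 1) n g) = L2_inner f (atom k n g) / of_real (sqrt 2)" for n
  proof -
    have "2 powr (of_int (k + 1) / 2) = sqrt 2 * 2 powr (of_int k / (2::real))"
      by (simp add: add_divide_distrib powr_add powr_half_sqrt)
    then have "atom (k + 1) n g = (\<lambda>x. of_real (sqrt 2) * atom k n g (2 * x))"
      by (simp add: atom_def fun_eq_iff power_int_add mult.assoc)
    then have "L2_inner (\<lambda>x. f (2 * x)) (atom (k + 1) n g) = of_real (sqrt 2) * (L2_inner f (atom k n g) / 2)"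
      using inner_affine[of 2 f 0 "atom k n g"] by (simp add: L2_inner_scale_right)
    also have "(2::complex) = of_real (sqrt 2) * of_real (sqrt 2)"
      by (simp flip: of_real_mult)
    finally show ?thesis by simp
  qed
  have f': "(\<lambda>x. f (2 * x)) \<in> L2" using L2_affine[OF f, of 2 0] by simp
  have norm: "(L2_norm (\<lambda>x. f (2 * x)))\<^sup>2 = 1/2 * (L2_norm f)\<^sup>2"
    using norm_affine_square[of 2 f 0] by simp
  have "(norm (L2_inner (\<lambda>x. f (2 * x)) (atom (k + 1) n g)))\<^sup>2 = 1/2 * (norm (L2_inner f (atom k n g)))\<^sup>2" for n
    unfolding inner by (simp add: norm_divide power_divide)
  then show ?thesis
    unfolding closed_span_iff_has_sum[OF L2_orthonormal_atoms[OF on]] norm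
    by (simp only: f f' has_sum_cmult_right_iff simp_thms) simp
qed

section \<open>Orthonormal wavelets from a multiresolution analysis\<close>

lemma has_sum_int_reflect:
  assumes "(f has_sum s) (UNIV :: int set)" shows "((\<lambda>j. f (c - j)) has_sum s) UNIV"
proof -
  have *: "bij_betw (\<lambda>j. c - j) UNIV (UNIV :: int set)"
    by (rule bij_betw_byWitness[where f' = "\<lambda>j. c - j"]) auto
  show ?thesis using assms has_sum_reindex_bij_betw[OF *, of f s] by blast
qed

lemma has_sum_int_shift:
  assumes "(f has_sum s) (UNIV :: int set)" shows "((\<lambda>j. f (j - c)) has_sum s) UNIV"
proof -
  have *: "bij_betw (\<lambda>j. j - c) UNIV (UNIV :: int set)"
    by (rule bij_betw_byWitness[where f' = "\<lambda>j. j + c"]) auto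
  show ?thesis using assms has_sum_reindex_bij_betw[OF *, of f s] by blast
qed

lemma has_sum_eq_0_if_antisymmetric:
  fixes f :: "int \<Rightarrow> complex"
  assumes "(f has_sum s) UNIV" and anti: "\<And>j. f (c - j) = - f j"
  shows "s = 0"
proof -
  have "((\<lambda>j. - f j) has_sum s) UNIV"
    using has_sum_int_reflect[OF assms(1), of c] by (simp add: anti)
  then have "s = - s" using has_sum_uminusI[OF assms(1)] by (rule has_sum_unique)
  then show ?thesis by simp
qed

text \<open>
  A multiresolution analysis in the ordinary sense, without chirps: the spaces are nested and related
  by dyadic dilation, and the integer translates of \<open>\<phi>\<close> form an orthonormal basis of \<open>W 0\<close>.
\<close>

locale multiresolution =
  fixes W :: "int \<Rightarrow> (real \<Rightarrow> complex) set" and \<phi> :: "real \<Rightarrow> complex"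
  assumes closed: "\<And>k. L2_closed_subspace (W k)"
    and W_Suc: "\<And>k. W k \<subseteq> W (k + 1)"
    and dilate: "\<And>k f. f \<in> L2 \<Longrightarrow> f \<in> W k \<longleftrightarrow> (\<lambda>x. f (2 * x)) \<in> W (k + 1)"
    and Inter_W: "\<And>f. (\<And>k. f \<in> W k) \<Longrightarrow> AE x in lborel. f x = 0"
    and dense: "L2_closure (\<Union>k. W k) = L2"
    and basis: "L2_orthonormal_basis (\<lambda>n. atom 0 n \<phi>) (W 0)"
begin

lemma orthonormal_\<phi>: "L2_orthonormal (\<lambda>n. atom k n \<phi>)"
  using basis by (auto simp: L2_orthonormal_basis_iff intro: L2_orthonormal_atoms[of \<phi> k])

lemma \<phi>_L2: "\<phi> \<in> L2"
  using L2_orthonormalD(1)[OF orthonormal_\<phi>, of 0 0] by simp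

lemma norm_\<phi>: "L2_norm \<phi> = 1"
proof -
  have "of_real ((L2_norm \<phi>)\<^sup>2) = complex_of_real 1"
    using L2_orthonormalD(2)[OF orthonormal_\<phi>, of 0 0 0] by (simp add: L2_inner_self)
  then have "(L2_norm \<phi>)\<^sup>2 = 1" unfolding of_real_eq_iff .
  then show ?thesis using L2_norm_nonneg[of \<phi>] by (simp add: power2_eq_1_iff)
qed

lemma W_subset_L2: "W k \<subseteq> L2"
  using closed by (rule closed_subspaceD)

lemma W_mono: "k \<le> l \<Longrightarrow> W k \<subseteq> W l"
proof (induction l rule: int_ge_induct)
  case (step l) then show ?case using W_Suc[of l] by blast
qed simp

text \<open>
  Being in a closed span is a numerical condition that scales under dilation, so the basis property
  propagates from scale \<open>0\<close> to all scales.
\<close>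

lemma W_eq: "W k = closed_span (\<lambda>n. atom k n \<phi>)"
proof (induction k rule: int_induct[where k = 0])
  case base
  show ?case using basis by (simp add: L2_orthonormal_basis_iff)
next
  case (step1 k)
  have "g \<in> W (k + 1) \<longleftrightarrow> g \<in> closed_span (\<lambda>n. atom (k + 1) n \<phi>)" if g: "g \<in> L2" for g
  proof -
    define f where "f = (\<lambda>x. g (1/2 * x - 0))"
    have f: "f \<in> L2" unfolding f_def using g by (rule L2_affine) simp
    have "g = (\<lambda>x. f (2 * x))" by (simp add: f_def)
    then show ?thesis
      using dilate[OF f, of k] closed_span_atom_dilate[OF orthonormal_\<phi> f, of k] step1 by simp
  qed
  then show ?case using W_subset_L2 closed_span_subset_L2 by blast
next
  case (step2 k)
  have "f \<in> W (k - 1) \<longleftrightarrow> f \<in> closed_span (\<lambda>n. atom (k - 1) n \<phi>)" if f: "f \<in> L2" for f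
    using dilate[OF f, of "k - 1"] closed_span_atom_dilate[OF orthonormal_\<phi> f, of "k - 1"] step2 by simp
  then show ?case using W_subset_L2 closed_span_subset_L2 by blast
qed

subsection \<open>The refinement coefficients\<close>

text \<open>
  The coefficients of \<open>\<phi>\<close> with respect to the basis \<open>atom 1 j \<phi>\<close> of \<open>W 1\<close>, and those of the wavelet to
  be constructed.
\<close>

definition a :: "int \<Rightarrow> complex" where "a j = L2_inner \<phi> (atom 1 j \<phi>)"

definition b :: "int \<Rightarrow> complex" where "b j = (-1) powi (1 - j) * cnj (a (1 - j))"

lemma inner_\<phi>_next: "L2_inner (atom k n \<phi>) (atom (k + 1) j \<phi>) = a (j - 2 * n)"
  by (simp add: inner_atom_next a_def)

lemma atom_\<phi>_in_W: "atom k n \<phi> \<in> W k"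
  unfolding W_eq using L2_orthonormalD(1)[OF orthonormal_\<phi>] by (rule closed_span_base)

lemma a_shift_orthonormal:
  "((\<lambda>j. a (j - 2 * n) * cnj (a (j - 2 * m))) has_sum (if n = m then 1 else 0)) UNIV"
proof -
  have "atom 0 n \<phi> \<in> closed_span (\<lambda>j. atom (0 + 1) j \<phi>)"
    using atom_\<phi>_in_W[of 0 n] W_Suc[of 0] W_eq by blast
  from Parseval[OF orthonormal_\<phi> this, of "atom 0 m \<phi>"] show ?thesis
    unfolding inner_\<phi>_next L2_orthonormalD(2)[OF orthonormal_\<phi>] using \<phi>_L2 by simp
qed

lemma norm_a_has_sum: "((\<lambda>j. (norm (a j))\<^sup>2) has_sum 1) UNIV"
proof -
  have "((\<lambda>j. complex_of_real ((norm (a j))\<^sup>2)) has_sum of_real 1) UNIV"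
    using a_shift_orthonormal[of 0 0] unfolding complex_norm_square by simp
  then show ?thesis unfolding has_sum_of_real_iff .
qed

lemma norm_b: "norm (b j) = norm (a (1 - j))"
  by (simp add: b_def norm_mult norm_power_int)

lemma norm_b_has_sum: "((\<lambda>j. (norm (b j))\<^sup>2) has_sum 1) UNIV"
  unfolding norm_b using has_sum_int_reflect[OF norm_a_has_sum] .

lemma b_shift_orthonormal:
  "((\<lambda>j. b (j - 2 * n) * cnj (b (j - 2 * m))) has_sum (if n = m then 1 else 0)) UNIV"
proof -
  have "b (j - 2 * n) * cnj (b (j - 2 * m)) =
      a ((1 + 2 * m + 2 * n - j) - 2 * n) * cnj (a ((1 + 2 * m + 2 * n - j) - 2 * m))" for j
  proof -
    \<comment> \<open>The two signs agree, as the shifts are even.\<close>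
    have "(-1) powi (1 - (j - 2 * n)) * cnj ((-1) powi (1 - (j - 2 * m))) = (1::complex)"
      by (cases "even j") auto
    then show ?thesis unfolding b_def by (simp add: algebra_simps)
  qed
  then show ?thesis
    using has_sum_int_reflect[OF a_shift_orthonormal[of n m], of "1 + 2 * m + 2 * n"] by simp
qed

text \<open>
  The reflection \<open>j \<mapsto> 1 + 2m + 2n - j\<close> exchanges the two factors taken from \<open>a\<close> and flips the sign,
  so the shifts of \<open>a\<close> and \<open>b\<close> are orthogonal.
\<close>

lemma a_b_shift_antisymmetric:
  fixes n m :: int
  defines "F \<equiv> \<lambda>j. a (j - 2 * n) * cnj (b (j - 2 * m))"
  shows "F (1 + 2 * m + 2 * n - j) = - F j"
  unfolding F_def b_def by (cases "even j") (simp_all add: algebra_simps)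

end

text \<open>
  A wavelet: an element \<open>\<psi>\<close> of \<open>W 1\<close> whose coefficients are the alternating reflection \<open>b\<close> of the
  refinement coefficients of \<open>\<phi>\<close>.
\<close>

locale wavelet = multiresolution +
  fixes \<psi> :: "real \<Rightarrow> complex"
  assumes \<psi>_W: "\<psi> \<in> W 1"
    and inner_\<psi>: "\<And>j. L2_inner \<psi> (atom 1 j \<phi>) = b j"
begin

lemma \<psi>_L2: "\<psi> \<in> L2"
  using \<psi>_W W_subset_L2 by blast

lemma inner_\<psi>_next: "L2_inner (atom k n \<psi>) (atom (k + 1) j \<phi>) = b (j - 2 * n)"
  by (simp add: inner_atom_next inner_\<psi>)

lemma \<psi>_expansion: "L2_has_sum (\<lambda>k x. b k * atom 1 k \<phi> x) \<psi>"
proof -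
  have "L2_has_sum (\<lambda>k x. L2_inner \<psi> (atom 1 k \<phi>) * atom 1 k \<phi> x) \<psi>"
    using \<psi>_W \<psi>_L2 unfolding W_eq
    by (intro has_sum_imp_L2_has_sum closed_span_imp_has_sum orthonormal_\<phi>)
  then show ?thesis unfolding inner_\<psi> .
qed

lemma norm_\<psi>: "(L2_norm \<psi>)\<^sup>2 = 1"
proof (rule has_sum_unique[OF _ norm_b_has_sum])
  show "((\<lambda>j. (norm (b j))\<^sup>2) has_sum (L2_norm \<psi>)\<^sup>2) UNIV"
    using closed_span_imp_has_sum[OF orthonormal_\<phi>, of \<psi> 1] \<psi>_W unfolding W_eq inner_\<psi> by blast
qed

lemma atom_\<psi>_in_W: "atom k n \<psi> \<in> W (k + 1)"
  unfolding W_eq closed_span_iff_has_sum[OF orthonormal_\<phi>] inner_\<psi>_next norm_atom norm_\<psi>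
  using \<psi>_L2 has_sum_int_shift[OF norm_b_has_sum, of "2 * n"] by simp

lemma inner_\<psi>_\<psi>_same: "L2_inner (atom k n \<psi>) (atom k m \<psi>) = (if n = m then 1 else 0)"
proof (rule has_sum_unique)
  show "((\<lambda>j. b (j - 2 * n) * cnj (b (j - 2 * m))) has_sum L2_inner (atom k n \<psi>) (atom k m \<psi>)) UNIV"
    using Parseval[OF orthonormal_\<phi>, of "atom k n \<psi>" "k + 1" "atom k m \<psi>"] atom_\<psi>_in_W[of k n] \<psi>_L2
    unfolding W_eq inner_\<psi>_next by simp
qed (rule b_shift_orthonormal)

lemma inner_\<phi>_\<psi>_same: "L2_inner (atom k n \<phi>) (atom k m \<psi>) = 0"
proof (rule has_sum_eq_0_if_antisymmetric)
  show "((\<lambda>j. a (j - 2 * n) * cnj (b (j - 2 * m))) has_sum L2_inner (atom k n \<phi>) (atom k m \<psi>)) UNIV"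
    using Parseval[OF orthonormal_\<phi>, of "atom k n \<phi>" "k + 1" "atom k m \<psi>"]
      atom_\<phi>_in_W[of k n] W_Suc[of k] \<psi>_L2
    unfolding W_eq inner_\<phi>_next inner_\<psi>_next by auto
qed (rule a_b_shift_antisymmetric)

lemma inner_\<psi>_orthogonal_W:
  assumes "f \<in> W k" shows "L2_inner f (atom k m \<psi>) = 0"
proof -
  have "L2_inner (atom k m \<psi>) f = L2_inner (\<lambda>x. 0) f"
  proof (rule closed_span_inner_eq[OF orthonormal_\<phi>])
    show "f \<in> closed_span (\<lambda>n. atom k n \<phi>)" using assms unfolding W_eq .
    have "L2_inner (atom k m \<psi>) (atom k n \<phi>) = 0" for n
      using inner_\<phi>_\<psi>_same[of k n m] L2_inner_commute[of "atom k m \<psi>" "atom k n \<phi>"] by simp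
    then show "L2_inner (atom k m \<psi>) (atom k n \<phi>) = L2_inner (\<lambda>x. 0) (atom k n \<phi>)" for n
      by (simp add: L2_inner_def)
  qed (use \<psi>_L2 in simp_all)
  also have "\<dots> = 0" by (simp add: L2_inner_def)
  finally show ?thesis using L2_inner_commute[of f "atom k m \<psi>"] by simp
qed

lemma orthonormal_\<psi>: "L2_orthonormal (\<lambda>(k, n). atom k n \<psi>)"
proof -
  have less: "L2_inner (atom k n \<psi>) (atom l m \<psi>) = 0" if "k < l" for k l n m
    using atom_\<psi>_in_W[of k n] W_mono[of "k + 1" l] that by (intro inner_\<psi>_orthogonal_W) auto
  have "L2_inner (atom k n \<psi>) (atom l m \<psi>) = (if k = l \<and> n = m then 1 else 0)" for k l n m
    using less[of k l n m] less[of l k m n] inner_\<psi>_\<psi>_same[of k n m]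
    by (cases k l rule: linorder_cases) (auto simp: L2_inner_commute[of "atom k n \<psi>"])
  then show ?thesis using \<psi>_L2 by (auto simp: L2_orthonormal_def)
qed

subsection \<open>Splitting one scale\<close>

text \<open>The joint family of the scaling atoms (left indices) and wavelets (right indices) at scale \<open>k\<close>.\<close>

definition split_atom :: "int \<Rightarrow> int + int \<Rightarrow> real \<Rightarrow> complex" where
  "split_atom k = case_sum (\<lambda>n. atom k n \<phi>) (\<lambda>n. atom k n \<psi>)"

lemma orthonormal_split_atom: "L2_orthonormal (split_atom k)"
  using L2_orthonormalD[OF orthonormal_\<phi>, of k] \<psi>_L2
  by (auto simp: L2_orthonormal_def split_atom_def inner_\<psi>_\<psi>_same inner_\<phi>_\<psi>_same
      L2_inner_commute[of "atom k _ \<psi>" "atom k _ \<phi>"] split: sum.splits)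

text \<open>
  The squared coefficients of \<open>atom (k + 1) j \<phi>\<close> are \<open>\<bar>a (j - 2n)\<bar>\<^sup>2\<close> and
  \<open>\<bar>b (j - 2n)\<bar>\<^sup>2 = \<bar>a (1 - j + 2n)\<bar>\<^sup>2\<close>. As \<open>j\<close> and \<open>1 - j\<close> have different parity, every index of \<open>a\<close>
  occurs exactly once, so Bessel's inequality is an equality.
\<close>

lemma atom_next_in_split: "atom (k + 1) j \<phi> \<in> closed_span (split_atom k)"
proof -
  \<comment> \<open>\<open>\<sigma>\<close> lists the indices of \<open>a\<close> that occur; \<open>\<tau>\<close> is its inverse.\<close>
  define \<sigma> where "\<sigma> = case_sum (\<lambda>n::int. j - 2 * n) (\<lambda>n. 1 - j + 2 * n)"
  define \<tau> where "\<tau> = (\<lambda>i. if even (j - i) then Inl ((j - i) div 2) else Inr ((i + j - 1) div 2))"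
  have "bij_betw \<sigma> UNIV UNIV"
  proof (rule bij_betw_byWitness[where f' = \<tau>])
    show "\<forall>i\<in>UNIV. \<sigma> (\<tau> i) = i" by (auto simp: \<sigma>_def \<tau>_def)
    have "\<tau> (\<sigma> z) = z" for z by (cases z) (simp_all add: \<sigma>_def \<tau>_def)
    then show "\<forall>z\<in>UNIV. \<tau> (\<sigma> z) = z" by blast
  qed simp_all
  then have "((\<lambda>z. (norm (a (\<sigma> z)))\<^sup>2) has_sum 1) UNIV"
    using has_sum_reindex_bij_betw[of \<sigma> UNIV UNIV "\<lambda>i. (norm (a i))\<^sup>2" 1] norm_a_has_sum by blast
  moreover have "norm (a (\<sigma> z)) = norm (L2_inner (atom (k + 1) j \<phi>) (split_atom k z))" for z
  proof -
    have "1 - (j - 2 * n) = 1 - j + 2 * n" for n by simp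
    then have "norm (a (\<sigma> z)) = norm (L2_inner (split_atom k z) (atom (k + 1) j \<phi>))"
      by (cases z) (simp_all only: \<sigma>_def split_atom_def sum.case inner_\<phi>_next inner_\<psi>_next norm_b)
    then show ?thesis
      unfolding L2_inner_commute[of "atom (k + 1) j \<phi>" "split_atom k z"] complex_mod_cnj .
  qed
  ultimately show ?thesis
    unfolding closed_span_iff_has_sum[OF orthonormal_split_atom] using \<phi>_L2
    by (simp add: norm_atom norm_\<phi>)
qed

lemma W_next_subset_split: "W (k + 1) \<subseteq> closed_span (split_atom k)"
  unfolding W_eq
  using L2_orthonormalD(1)[OF orthonormal_split_atom]
  by (intro closed_span_minimal closed_subspace_closed_span atom_next_in_split)

lemma orthogonal_complement_subset:
  assumes h: "h \<in> W (k + 1)" and orth: "\<And>n. L2_inner h (atom k n \<phi>) = 0"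
  shows "h \<in> closed_span (\<lambda>n. atom k n \<psi>)"
proof -
  have on: "L2_orthonormal (\<lambda>n. atom k n \<psi>)"
    using \<psi>_L2 by (auto simp: L2_orthonormal_def inner_\<psi>_\<psi>_same)
  have "((\<lambda>z. (norm (L2_inner h (split_atom k z)))\<^sup>2) has_sum (L2_norm h)\<^sup>2) UNIV"
    using h W_next_subset_split by (intro closed_span_imp_has_sum orthonormal_split_atom) blast
  also have "?this \<longleftrightarrow>
      ((\<lambda>z. (norm (L2_inner h (split_atom k z)))\<^sup>2) has_sum (L2_norm h)\<^sup>2) (range Inr)"
  proof (rule has_sum_cong_neutral)
    fix z :: "int + int" assume "z \<in> UNIV - range Inr"
    then obtain n where "z = Inl n" by (cases z) auto
    then show "(norm (L2_inner h (split_atom k z)))\<^sup>2 = 0" by (simp add: split_atom_def orth)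
  qed auto
  also have "\<dots> \<longleftrightarrow> ((\<lambda>n. (norm (L2_inner h (atom k n \<psi>)))\<^sup>2) has_sum (L2_norm h)\<^sup>2) UNIV"
    by (subst has_sum_reindex) (simp_all add: o_def split_atom_def)
  finally show ?thesis
    unfolding closed_span_iff_has_sum[OF on] using h W_subset_L2 by blast
qed

subsection \<open>Completeness of the wavelet system\<close>

text \<open>The orthogonal projection onto \<open>W k\<close>.\<close>

definition P :: "int \<Rightarrow> (real \<Rightarrow> complex) \<Rightarrow> real \<Rightarrow> complex" where
  "P k = proj (\<lambda>n. atom k n \<phi>)"

lemma P_in_W: "f \<in> L2 \<Longrightarrow> P k f \<in> W k"
  unfolding P_def W_eq by (rule proj_closed_span[OF orthonormal_\<phi>])

lemma P_L2: "f \<in> L2 \<Longrightarrow> P k f \<in> L2"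
  using P_in_W W_subset_L2 by blast

lemma inner_P: "f \<in> L2 \<Longrightarrow> v \<in> W k \<Longrightarrow> L2_inner (P k f) v = L2_inner f v"
  unfolding P_def W_eq by (rule proj_inner_closed_span[OF orthonormal_\<phi>])

lemma P_best_approximation:
  "f \<in> L2 \<Longrightarrow> v \<in> W k \<Longrightarrow> L2_norm (\<lambda>x. P k f x - f x) \<le> L2_norm (\<lambda>x. v x - f x)"
  unfolding P_def W_eq by (rule proj_best_approximation[OF orthonormal_\<phi>])

lemma P_tendsto_self:
  assumes f: "f \<in> L2"
  shows "(\<lambda>m. L2_norm (\<lambda>x. P (int m) f x - f x)) \<longlonglongrightarrow> 0"
proof (rule LIMSEQ_I)
  fix \<epsilon> :: real assume "\<epsilon> > 0"
  then obtain k v where v: "v \<in> W k" "L2_norm (\<lambda>x. v x - f x) < \<epsilon>"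
    using f dense unfolding L2_closure_iff set_eq_iff by blast
  have "L2_norm (\<lambda>x. P (int m) f x - f x) < \<epsilon>" if "m \<ge> nat k" for m
  proof -
    have "W k \<subseteq> W (int m)" using that by (intro W_mono) linarith
    then have "v \<in> W (int m)" using v(1) by blast
    then show ?thesis using P_best_approximation[OF f] v(2) by (meson le_less_trans)
  qed
  then show "\<exists>N. \<forall>m\<ge>N. norm (L2_norm (\<lambda>x. P (int m) f x - f x) - 0) < \<epsilon>" by auto
qed

lemma P_diff_norm_square:
  assumes f: "f \<in> L2" and kl: "k \<le> l"
  shows "(L2_norm (\<lambda>x. P k f x - P l f x))\<^sup>2 = (L2_norm (P l f))\<^sup>2 - (L2_norm (P k f))\<^sup>2"
proof -
  have "P k f \<in> W l" using P_in_W[OF f] W_mono[OF kl] by blast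
  then have "L2_inner (P l f) (P k f) = L2_inner (P k f) (P k f)"
    using inner_P[OF f, of "P k f"] P_in_W[OF f] by simp
  then have "Re (L2_inner (P k f) (P l f)) = (L2_norm (P k f))\<^sup>2"
    by (simp add: L2_inner_commute[of "P k f" "P l f"] L2_inner_self del: of_real_power)
  then show ?thesis by (simp add: L2_norm_diff_square P_L2 f)
qed

text \<open>
  The projections onto coarser and coarser spaces have decreasing norms, hence form a Cauchy
  sequence; its limit belongs to all the spaces, so it vanishes.
\<close>

lemma P_tendsto_0:
  assumes f: "f \<in> L2"
  shows "(\<lambda>m. L2_norm (P (- int m) f)) \<longlonglongrightarrow> 0"
proof -
  define s where "s m = P (- int m) f" for m
  have s: "s m \<in> L2" for m unfolding s_def using f by (rule P_L2)
  define N where "N m = (L2_norm (s m))\<^sup>2" for m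
  have dist: "(L2_norm (\<lambda>x. s n x - s m x))\<^sup>2 = N m - N n" if "m \<le> n" for m n
    unfolding s_def N_def using that by (intro P_diff_norm_square f) simp
  then have "decseq N" unfolding decseq_def by (metis diff_ge_0_iff_ge zero_le_power2)
  then have "convergent N"
    by (rule decseq_convergent[of N 0]) (auto simp: N_def intro: convergentI)
  moreover have "(L2_norm (\<lambda>x. s n x - s m x))\<^sup>2 = \<bar>N n - N m\<bar>" if "m \<le> n" for m n
    using dist[OF that] zero_le_power2[of "L2_norm (\<lambda>x. s n x - s m x)"] by linarith
  ultimately obtain g where g: "g \<in> L2" "(\<lambda>m. L2_norm (\<lambda>x. s m x - g x)) \<longlonglongrightarrow> 0"
    by (rule L2_convergent_if_dist_square[OF s])
  have "g \<in> W k" for k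
  proof -
    have sW: "s (m + nat (- k)) \<in> W k" for m
    proof -
      have "W (- int (m + nat (- k))) \<subseteq> W k" by (rule W_mono) simp
      then show ?thesis unfolding s_def using P_in_W[OF f] by blast
    qed
    have "(\<lambda>m. L2_norm (\<lambda>x. s (m + nat (- k)) x - g x)) \<longlonglongrightarrow> 0"
      using g(2) by (rule LIMSEQ_ignore_initial_segment)
    then have "g \<in> L2_closure (W k)"
      using g(1) sW unfolding L2_closure_def
      by (intro CollectI conjI exI[of _ "\<lambda>m. s (m + nat (- k))"]) auto
    then show ?thesis using closed_subspaceD(3)[OF closed] by blast
  qed
  then have "L2_norm g = 0" using Inter_W g(1) by (simp add: L2_norm_eq_0_iff)
  have "L2_norm (s m) \<le> L2_norm (\<lambda>x. s m x - g x)" for m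
    using L2_norm_triangle_diff[OF s[of m] g(1) L2_zero] \<open>L2_norm g = 0\<close> by simp
  then have "(\<lambda>m. L2_norm (s m)) \<longlonglongrightarrow> 0"
    by (intro tendsto_sandwich[OF _ _ tendsto_const g(2)]) auto
  then show ?thesis unfolding s_def .
qed

lemma P_step_in_closed_span:
  assumes f: "f \<in> L2"
  shows "(\<lambda>x. P (k + 1) f x - P k f x) \<in> closed_span (\<lambda>(k, n). atom k n \<psi>)" (is "?h \<in> ?T")
proof -
  have T: "L2_closed_subspace ?T" using \<psi>_L2 by (intro closed_subspace_closed_span) auto
  have "?h \<in> closed_span (\<lambda>n. atom k n \<psi>)"
  proof (rule orthogonal_complement_subset)
    show "?h \<in> W (k + 1)"
      using P_in_W[OF f] W_Suc by (intro closed_subspace_diff[OF closed]) blast+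
    fix n
    have "atom k n \<phi> \<in> W (k + 1)" using atom_\<phi>_in_W W_Suc by blast
    then show "L2_inner ?h (atom k n \<phi>) = 0"
      using f \<phi>_L2 atom_\<phi>_in_W by (simp add: L2_inner_diff_left P_L2 inner_P)
  qed
  also have "\<dots> \<subseteq> ?T"
  proof (rule closed_span_minimal[OF T])
    fix n
    show "atom k n \<psi> \<in> ?T"
      using closed_span_base[of "\<lambda>(k, n). atom k n \<psi>" "(k, n)"] \<psi>_L2 by auto
  qed
  finally show ?thesis .
qed

lemma wavelet_basis: "L2_orthonormal_basis (\<lambda>(k, n). atom k n \<psi>) L2"
  unfolding L2_orthonormal_basis_iff
proof (intro conjI equalityI subsetI)
  let ?T = "closed_span (\<lambda>(k, n). atom k n \<psi>)"
  show "L2_orthonormal (\<lambda>(k, n). atom k n \<psi>)" by (rule orthonormal_\<psi>)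
  show "f \<in> L2" if "f \<in> ?T" for f using that by (rule closed_span_L2)
  fix f assume f: "f \<in> L2"
  have T: "L2_closed_subspace ?T" using \<psi>_L2 by (intro closed_subspace_closed_span) auto
  have range: "(\<lambda>x. P (k + int n) f x - P k f x) \<in> ?T" for k n
  proof (induction n)
    case 0
    show ?case using closed_subspaceD(2)[OF T] by simp
  next
    case (Suc n)
    have "(\<lambda>x. (P (k + int n + 1) f x - P (k + int n) f x) + (P (k + int n) f x - P k f x)) \<in> ?T"
      using P_step_in_closed_span[OF f] Suc by (rule closed_subspaceD(4)[OF T])
    then show ?case by (simp add: ac_simps)
  qed
  \<comment> \<open>The differences of consecutive projections telescope.\<close>
  have s: "(\<lambda>x. P (int m) f x - P (- int m) f x) \<in> ?T" for m
    using range[of "- int m" "2 * m"] by simp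
  have "(\<lambda>m. L2_norm (\<lambda>x. (P (int m) f x - P (- int m) f x) - f x)) \<longlonglongrightarrow> 0"
  proof (rule tendsto_sandwich[OF _ _ tendsto_const])
    show "(\<lambda>m. L2_norm (\<lambda>x. P (int m) f x - f x) + L2_norm (P (- int m) f)) \<longlonglongrightarrow> 0"
      using tendsto_add[OF P_tendsto_self[OF f] P_tendsto_0[OF f]] by simp
    have "L2_norm (\<lambda>x. (P (int m) f x - P (- int m) f x) - f x)
        \<le> L2_norm (\<lambda>x. P (int m) f x - f x) + L2_norm (P (- int m) f)" for m
      using L2_norm_triangle_diff[OF L2_diff[OF P_L2[OF f] f] L2_zero P_L2[OF f], of "int m" "- int m"]
        L2_norm_minus_commute[of "\<lambda>x. 0" "P (- int m) f"]
      by (simp add: algebra_simps)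
    then show "\<forall>\<^sub>F m in sequentially. L2_norm (\<lambda>x. (P (int m) f x - P (- int m) f x) - f x)
        \<le> L2_norm (\<lambda>x. P (int m) f x - f x) + L2_norm (P (- int m) f)" by simp
  qed simp
  with s f have "f \<in> L2_closure ?T"
    unfolding L2_closure_def[of ?T]
    by (intro CollectI conjI exI[of _ "\<lambda>m x. P (int m) f x - P (- int m) f x"]) auto
  then show "f \<in> ?T" using closed_subspaceD(3)[OF T] by blast
qed

end

lemma (in multiresolution) ex_wavelet: "\<exists>\<psi>. wavelet W \<phi> \<psi>"
proof -
  have "(\<lambda>j. (norm (b j))\<^sup>2) summable_on UNIV"
    using norm_b_has_sum by (rule has_sum_imp_summable)
  then obtain \<psi> where "\<psi> \<in> closed_span (\<lambda>n. atom 1 n \<phi>)" "\<And>j. L2_inner \<psi> (atom 1 j \<phi>) = b j"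
    using ex_coefficients[OF orthonormal_\<phi>] by blast
  then have "wavelet W \<phi> \<psi>" by unfold_locales (simp_all add: W_eq)
  then show ?thesis by blast
qed

section \<open>Multiplication by unimodular functions\<close>

text \<open>
  A measurable function of constant modulus one; multiplication by it is a unitary operator, which
  preserves orthonormal families and closed spans, even if the members of the family are also multiplied
  by constants \<open>c i\<close> of modulus one.
\<close>

locale unimodular =
  fixes u :: "real \<Rightarrow> complex"
  assumes u_measurable [measurable]: "u \<in> borel_measurable borel"
    and norm_u [simp]: "norm (u x) = 1"
begin

lemma u_cnj [simp]: "u x * cnj (u x) = 1" "cnj (u x) * u x = 1"
  by (simp_all add: mult.commute flip: complex_norm_square)

lemma unimodular_cnj: "unimodular (\<lambda>x. cnj (u x))"
  by unfold_locales simp_all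

lemma L2_mult:
  assumes "f \<in> L2" shows "(\<lambda>x. u x * f x) \<in> L2"
proof (rule L2_I)
  have [measurable]: "f \<in> borel_measurable borel" using assms by (rule L2_measurable)
  show "(\<lambda>x. u x * f x) \<in> borel_measurable borel" by measurable
qed (use L2_integrable[OF assms] in \<open>simp add: norm_mult\<close>)

lemma norm_mult_u: "L2_norm (\<lambda>x. u x * f x) = L2_norm f"
  by (simp add: L2_norm_def norm_mult)

lemma norm_mult_u_diff: "L2_norm (\<lambda>x. u x * f x - u x * g x) = L2_norm (\<lambda>x. f x - g x)"
  using norm_mult_u[of "\<lambda>x. f x - g x"] by (simp add: right_diff_distrib)

lemma inner_mult_u: "L2_inner (\<lambda>x. u x * f x) (\<lambda>x. u x * g x) = L2_inner f g"
proof -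
  have "u x * f x * cnj (u x * g x) = f x * cnj (g x)" for x
    using u_cnj(1)[of x] by (simp add: algebra_simps)
  then show ?thesis unfolding L2_inner_def by (simp only:)
qed

lemma L2_has_sum_mult:
  assumes "L2_has_sum v f" shows "L2_has_sum (\<lambda>i x. u x * v i x) (\<lambda>x. u x * f x)"
  using assms by (simp add: L2_has_sum_def L2_mult norm_mult_u_diff flip: sum_distrib_left)

lemma L2_orthonormal_mult:
  assumes e: "L2_orthonormal e" and c: "\<And>i. norm (c i) = 1"
  shows "L2_orthonormal (\<lambda>i x. c i * (u x * e i x))"
  unfolding L2_orthonormal_def
proof (intro conjI allI)
  note eD = L2_orthonormalD[OF e]
  show "(\<lambda>x. c i * (u x * e i x)) \<in> L2" for i using eD(1) by (intro L2_scale L2_mult)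
  have "c i * cnj (c i) = 1" for i using c[of i] by (simp flip: complex_norm_square)
  then show "L2_inner (\<lambda>x. c i * (u x * e i x)) (\<lambda>x. c j * (u x * e j x)) = (if i = j then 1 else 0)"
    for i j
    by (simp add: L2_inner_scale_left L2_inner_scale_right inner_mult_u eD(2))
qed

lemma closed_span_mult_iff:
  assumes e: "L2_orthonormal e" and c: "\<And>i. norm (c i) = 1" and f: "f \<in> L2"
  shows "(\<lambda>x. u x * f x) \<in> closed_span (\<lambda>i x. c i * (u x * e i x)) \<longleftrightarrow> f \<in> closed_span e"
  unfolding closed_span_iff_has_sum[OF e] closed_span_iff_has_sum[OF L2_orthonormal_mult[OF e c]]
  by (simp add: L2_inner_scale_right inner_mult_u norm_mult_u norm_mult c f L2_mult)

end

section \<open>Removing the chirp\<close>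

text \<open>The chirp \<open>E x = exp (- \<i> (A x\<^sup>2 + 2 p x) / (2 B))\<close>, a factor of every \<open>sa_atom S k n g\<close>.\<close>

definition chirp :: "special_affine \<Rightarrow> real \<Rightarrow> complex" where
  "chirp S x = exp (- (\<i> / of_real (2 * coef_B S)) *
     of_real (coef_A S * x\<^sup>2 + 2 * coef_p S * x))"

lemma unimodular_chirp: "unimodular (chirp S)"
proof
  show "chirp S \<in> borel_measurable borel"
    unfolding chirp_def by (intro borel_measurable_continuous_onI continuous_intros)
  show "norm (chirp S x) = 1" for x
    by (simp add: chirp_def norm_exp_eq_Re Re_divide)
qed

lemma cnj_chirp: "cnj (chirp S x) = exp (\<i> / of_real (2 * coef_B S) *
     of_real (coef_A S * x\<^sup>2 + 2 * coef_p S * x))"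
  by (simp add: chirp_def exp_cnj)

lemma chirp_mult:
  "chirp S x * chirp S y =
    exp (- (\<i> / of_real (2 * coef_B S)) *
      of_real (coef_A S * (x\<^sup>2 + y\<^sup>2) + 2 * coef_p S * (x + y)))"
  unfolding chirp_def exp_add[symmetric] distrib_left[symmetric] of_real_add[symmetric]
  by (simp only: algebra_simps)

lemma chirp_mult_cnj:
  "chirp S x * cnj (chirp S y) =
    exp (- (\<i> / of_real (2 * coef_B S)) *
      of_real (coef_A S * (x\<^sup>2 - y\<^sup>2) + 2 * coef_p S * (x - y)))"
proof -
  have *: "cnj (chirp S y) = exp (- (\<i> / of_real (2 * coef_B S)) *
     of_real (- (coef_A S * y\<^sup>2 + 2 * coef_p S * y)))"
    unfolding cnj_chirp by (simp only: of_real_minus minus_mult_minus)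
  show ?thesis
    unfolding * unfolding chirp_def exp_add[symmetric] distrib_left[symmetric] of_real_add[symmetric]
    by (rule arg_cong[where f = "\<lambda>t. exp (- (\<i> / of_real (2 * coef_B S)) * of_real t)"])
      (simp add: algebra_simps)
qed

lemma sa_atom_eq:
  "sa_atom S k n g = (\<lambda>x. cnj (chirp S (of_int n / 2 powi k)) * (chirp S x * atom k n g x))"
  unfolding sa_atom_def atom_def fun_eq_iff chirp_mult_cnj[symmetric] by (simp add: mult_ac)

text \<open>
  Dividing the members of every \<open>V k\<close> by the chirp gives an ordinary multiresolution analysis with the
  same scaling function.
\<close>

lemma SAMRA_imp_multiresolution:
  assumes S: "SAMRA S V" and \<phi>: "scaling_function S V \<phi>"
  shows "multiresolution (\<lambda>k. {f \<in> L2. (\<lambda>x. chirp S x * f x) \<in> V k}) \<phi>"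
proof -
  interpret u: unimodular "chirp S" by (rule unimodular_chirp)
  interpret uc: unimodular "\<lambda>x. cnj (chirp S x)" by (rule u.unimodular_cnj)
  define W where "W = (\<lambda>k. {f \<in> L2. (\<lambda>x. chirp S x * f x) \<in> V k})"
  have VS: "L2_closed_subspace (V k)" for k using S by (simp add: SAMRA_def)
  note V = closed_subspaceD[OF VS]
  have cancel: "chirp S x * (cnj (chirp S x) * z) = z" "cnj (chirp S x) * (chirp S x * z) = z" for x z
    by (simp_all flip: mult.assoc)
  have "multiresolution W \<phi>"
  proof
    fix k
    show "L2_closed_subspace (W k)"
      unfolding L2_closed_subspace_def
    proof (intro conjI ballI allI subsetI)
      show "f \<in> L2" if "f \<in> W k" for f using that by (simp add: W_def)
      show "(\<lambda>x. 0) \<in> W k" using V(2) by (simp add: W_def)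
      show "(\<lambda>x. f x + g x) \<in> W k" if "f \<in> W k" "g \<in> W k" for f g
        using that V(4) by (auto simp: W_def distrib_left)
      show "(\<lambda>x. c * f x) \<in> W k" if "f \<in> W k" for c f
        using that V(5)[of "\<lambda>x. chirp S x * f x" k c]
        by (auto simp: W_def mult.left_commute[of c])
      fix f assume f: "f \<in> L2_closure (W k)"
      then have f2: "f \<in> L2" by (simp add: L2_closure_def)
      obtain s :: "nat \<Rightarrow> _" where s: "\<And>j. s j \<in> W k" "(\<lambda>j. L2_norm (\<lambda>x. s j x - f x)) \<longlonglongrightarrow> 0"
        using f by (auto simp: L2_closure_def)
      have "(\<lambda>x. chirp S x * f x) \<in> L2_closure (V k)"
        unfolding L2_closure_def
        using s f2
        by (intro CollectI conjI exI[of _ "\<lambda>j x. chirp S x * s j x"])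
          (auto simp: W_def u.norm_mult_u_diff u.L2_mult)
      then show "f \<in> W k" using V(3) f2 by (auto simp: W_def)
    qed
    show "W k \<subseteq> W (k + 1)" using S by (auto simp: SAMRA_def W_def)
    show "f \<in> W k \<longleftrightarrow> (\<lambda>x. f (2 * x)) \<in> W (k + 1)" if f: "f \<in> L2" for f
    proof -
      have "exp (\<i> / of_real (2 * coef_B S) * of_real (3 * coef_A S * x\<^sup>2 + 2 * x * coef_p S)) *
          chirp S (2 * x) = chirp S x" for x
        unfolding chirp_def exp_add[symmetric] minus_mult_left[symmetric] minus_mult_right
          of_real_minus[symmetric] distrib_left[symmetric] of_real_add[symmetric]
        by (simp add: algebra_simps power2_eq_square)
      then have "(\<lambda>x. exp (\<i> / of_real (2 * coef_B S) * of_real (3 * coef_A S * x\<^sup>2 + 2 * x * coef_p S)) *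
          (chirp S (2 * x) * f (2 * x))) = (\<lambda>x. chirp S x * f (2 * x))"
        by (simp only: mult.assoc[symmetric])
      moreover have "(\<lambda>x. f (2 * x)) \<in> L2" using L2_affine[OF f, of 2 0] by simp
      ultimately show ?thesis
        using S f u.L2_mult[OF f] unfolding SAMRA_def W_def by auto
    qed
  next
    fix f assume "\<And>k. f \<in> W k"
    then have "(\<lambda>x. chirp S x * f x) \<in> (\<Inter>k. V k)" by (simp add: W_def)
    moreover have "(\<Inter>k. V k) = {f \<in> L2. AE x in lborel. f x = 0}"
      using S unfolding SAMRA_def by (elim conjE)
    ultimately have "AE x in lborel. chirp S x * f x = 0" by blast
    then show "AE x in lborel. f x = 0"
      by eventually_elim (simp add: chirp_def)
  next
    show "L2_closure (\<Union>k. W k) = L2"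
    proof (intro equalityI subsetI)
      show "f \<in> L2" if "f \<in> L2_closure (\<Union>k. W k)" for f using that by (simp add: L2_closure_def)
      fix f assume f: "f \<in> L2"
      show "f \<in> L2_closure (\<Union>k. W k)"
        unfolding L2_closure_iff
      proof (intro conjI allI impI f)
        fix \<epsilon> :: real assume "\<epsilon> > 0"
        have "(\<lambda>x. chirp S x * f x) \<in> L2_closure (\<Union>k. V k)"
          using S u.L2_mult[OF f] by (simp add: SAMRA_def)
        then obtain g k where g: "g \<in> V k" "L2_norm (\<lambda>x. g x - chirp S x * f x) < \<epsilon>"
          using \<open>\<epsilon> > 0\<close> unfolding L2_closure_iff by blast
        have "(\<lambda>x. cnj (chirp S x) * g x) \<in> W k"
          using g(1) V(1)[of k] by (auto simp: W_def cancel uc.L2_mult)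
        moreover have "L2_norm (\<lambda>x. cnj (chirp S x) * g x - f x) < \<epsilon>"
          using g(2) uc.norm_mult_u_diff[of g "\<lambda>x. chirp S x * f x"] by (simp add: cancel)
        ultimately show "\<exists>v\<in>\<Union>k. W k. L2_norm (\<lambda>x. v x - f x) < \<epsilon>"
          by (intro bexI[where x = "\<lambda>x. cnj (chirp S x) * g x"]) auto
      qed
    qed
  next
    have V0: "L2_orthonormal (\<lambda>n. sa_atom S 0 n \<phi>)" "closed_span (\<lambda>n. sa_atom S 0 n \<phi>) = V 0"
      using \<phi> by (auto simp: scaling_function_def L2_orthonormal_basis_iff)
    have sa: "(\<lambda>n. sa_atom S 0 n \<phi>) = (\<lambda>n x. cnj (chirp S (of_int n)) * (chirp S x * atom 0 n \<phi> x))"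
      by (simp add: sa_atom_eq)
    have "L2_orthonormal (\<lambda>n x. chirp S (of_int n) * (cnj (chirp S x) * sa_atom S 0 n \<phi> x))"
      by (rule uc.L2_orthonormal_mult[OF V0(1)]) simp
    also have "(\<lambda>n x. chirp S (of_int n) * (cnj (chirp S x) * sa_atom S 0 n \<phi> x)) = (\<lambda>n. atom 0 n \<phi>)"
    proof (intro ext)
      fix n x
      have "chirp S (of_int n) * (cnj (chirp S x) * sa_atom S 0 n \<phi> x) =
          (chirp S (of_int n) * cnj (chirp S (of_int n))) * ((cnj (chirp S x) * chirp S x) * atom 0 n \<phi> x)"
        by (simp add: sa_atom_eq del: u.u_cnj)
      then show "chirp S (of_int n) * (cnj (chirp S x) * sa_atom S 0 n \<phi> x) = atom 0 n \<phi> x" by simp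
    qed
    finally have on: "L2_orthonormal (\<lambda>n. atom 0 n \<phi>)" .
    have "f \<in> closed_span (\<lambda>n. atom 0 n \<phi>) \<longleftrightarrow> f \<in> W 0" for f
    proof (cases "f \<in> L2")
      case True
      then show ?thesis
        using u.closed_span_mult_iff[OF on, of "\<lambda>n. cnj (chirp S (of_int n))" f] V0(2)
        unfolding sa W_def by simp
    qed (auto simp: W_def L2_closure_def)
    then show "L2_orthonormal_basis (\<lambda>n. atom 0 n \<phi>) (W 0)"
      unfolding L2_orthonormal_basis_iff using on by blast
  qed
  then show ?thesis unfolding W_def .
qed

lemma sa_atom_basis:
  assumes "L2_orthonormal_basis (\<lambda>(k, n). atom k n \<psi>) L2"
  shows "L2_orthonormal_basis (\<lambda>(k, n). sa_atom S k n \<psi>) L2"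
proof -
  interpret u: unimodular "chirp S" by (rule unimodular_chirp)
  interpret uc: unimodular "\<lambda>x. cnj (chirp S x)" by (rule u.unimodular_cnj)
  let ?e = "\<lambda>(k, n). atom k n \<psi>" and ?c = "\<lambda>(k, n). cnj (chirp S (of_int n / 2 powi k))"
  have on: "L2_orthonormal ?e" and full: "closed_span ?e = L2"
    using assms by (auto simp: L2_orthonormal_basis_iff)
  have c: "norm (?c i) = 1" for i by (simp add: case_prod_beta)
  have sa: "(\<lambda>(k, n). sa_atom S k n \<psi>) = (\<lambda>i x. ?c i * (chirp S x * ?e i x))"
    by (simp add: fun_eq_iff sa_atom_eq)
  have "f \<in> closed_span (\<lambda>i x. ?c i * (chirp S x * ?e i x))" if f: "f \<in> L2" for f
  proof -
    have "(\<lambda>x. chirp S x * (cnj (chirp S x) * f x)) \<in> closed_span (\<lambda>i x. ?c i * (chirp S x * ?e i x))"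
      using u.closed_span_mult_iff[where c = ?c, OF on c uc.L2_mult[OF f]] full uc.L2_mult[OF f] by blast
    then show ?thesis by (simp flip: mult.assoc)
  qed
  then have "closed_span (\<lambda>i x. ?c i * (chirp S x * ?e i x)) = L2"
    by (intro equalityI closed_span_subset_L2 subsetI)
  moreover have "L2_orthonormal (\<lambda>i x. ?c i * (chirp S x * ?e i x))"
    using on c by (rule u.L2_orthonormal_mult)
  ultimately show ?thesis
    unfolding L2_orthonormal_basis_iff sa by (rule conjI[rotated])
qed

section \<open>The special affine wavelet\<close>

theorem theorem3p4:
  fixes A B C D p q :: real
    and M :: "real^2^2" and \<Lambda> :: "real^2" and S :: special_affine
    and V :: "int \<Rightarrow> (real \<Rightarrow> complex) set"
    and \<phi> :: "real \<Rightarrow> complex"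
    and h d :: "int \<Rightarrow> complex"
  assumes "M = vector [vector [A, B], vector [C, D]]"
    and "det M = 1"
    and "B > 0"
    and "\<Lambda> = vector [p, q]"
    and "S = (M, \<Lambda>)"
    and "SAMRA S V"
    and "scaling_function S V \<phi>"
    and "\<And>k. h k = of_real (sqrt 2) *
           (LINT x|lborel.
              exp (- (\<i> / of_real (2 * B)) * of_real (A * (of_int k)\<^sup>2 / 4 + p * of_int k)) *
              \<phi> x * cnj (\<phi> (2 * x - of_int k)))"
    and "\<And>k. d k = (-1) powi (1 - k) * cnj (h (1 - k)) *
           exp (- (\<i> / of_real (2 * B)) *
                of_real (A * ((1 - of_int k)\<^sup>2 + (of_int k)\<^sup>2) / 4 + p))"
  shows "\<exists>\<psi>\<in>L2.
           L2_has_sum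
             (\<lambda>k x. of_real (sqrt 2) *
                (d k *
                 exp (- (\<i> / of_real (2 * B)) *
                   of_real (A * (x\<^sup>2 - (of_int k)\<^sup>2 / 4) + 2 * p * (x - of_int k / 2))) *
                 \<phi> (2 * x - of_int k)))
             (sa_atom S 0 0 \<psi>) \<and>
           L2_orthonormal_basis (\<lambda>(k, n). sa_atom S k n \<psi>) L2"
proof -
  have coef: "coef_A S = A" "coef_B S = B" "coef_p S = p"
    using assms(1,4,5) by (simp_all add: coef_A_def coef_B_def coef_p_def)
  interpret u: unimodular "chirp S" by (rule unimodular_chirp)
  interpret multiresolution "\<lambda>k. {f \<in> L2. (\<lambda>x. chirp S x * f x) \<in> V k}" \<phi>
    using assms(6,7) by (rule SAMRA_imp_multiresolution)
  obtain \<psi> where "wavelet (\<lambda>k. {f \<in> L2. (\<lambda>x. chirp S x * f x) \<in> V k}) \<phi> \<psi>"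
    using ex_wavelet by blast
  then interpret wavelet "\<lambda>k. {f \<in> L2. (\<lambda>x. chirp S x * f x) \<in> V k}" \<phi> \<psi> .
  have atom1: "atom 1 k \<phi> x = of_real (sqrt 2) * \<phi> (2 * x - of_int k)" for k x
    by (simp add: atom_def powr_half_sqrt)
  have h: "h k = chirp S (of_int k / 2) * a k" for k
  proof -
    have "exp (- (\<i> / of_real (2 * B)) * of_real (A * (of_int k)\<^sup>2 / 4 + p * of_int k)) =
        chirp S (of_int k / 2)"
      by (simp add: chirp_def coef power_divide)
    moreover have "a k = of_real (sqrt 2) * (LINT x|lborel. \<phi> x * cnj (\<phi> (2 * x - of_int k)))"
      unfolding a_def L2_inner_def atom1
      by (simp add: mult.left_commute[of "\<phi> _" "of_real (sqrt 2)"])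
    ultimately show ?thesis
      unfolding assms(8) by (simp add: mult.assoc)
  qed
  have d: "d k = b k * chirp S (of_int k / 2)" for k
  proof -
    have "A * ((1 - of_int k)\<^sup>2 + (of_int k)\<^sup>2) / 4 + p =
        A * ((of_int (1 - k) / 2)\<^sup>2 + (of_int k / 2)\<^sup>2) + 2 * p * (of_int (1 - k) / 2 + of_int k / 2)"
      by (simp add: power_divide field_simps)
    then have "exp (- (\<i> / of_real (2 * B)) * of_real (A * ((1 - of_int k)\<^sup>2 + (of_int k)\<^sup>2) / 4 + p)) =
        chirp S (of_int (1 - k) / 2) * chirp S (of_int k / 2)"
      unfolding chirp_mult coef by (simp only:)
    then have "d k = (-1) powi (1 - k) * cnj (a (1 - k)) *
        (cnj (chirp S (of_int (1 - k) / 2)) * chirp S (of_int (1 - k) / 2)) * chirp S (of_int k / 2)"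
      unfolding assms(9) h by (simp only: complex_cnj_mult mult_ac)
    then show ?thesis by (simp add: b_def)
  qed
  have summand: "of_real (sqrt 2) * (d k *
        exp (- (\<i> / of_real (2 * B)) *
          of_real (A * (x\<^sup>2 - (of_int k)\<^sup>2 / 4) + 2 * p * (x - of_int k / 2))) *
        \<phi> (2 * x - of_int k)) = chirp S x * (b k * atom 1 k \<phi> x)" for k x
  proof -
    have "exp (- (\<i> / of_real (2 * B)) *
          of_real (A * (x\<^sup>2 - (of_int k)\<^sup>2 / 4) + 2 * p * (x - of_int k / 2))) =
        chirp S x * cnj (chirp S (of_int k / 2))"
      unfolding chirp_mult_cnj coef by (simp add: power_divide)
    then have "of_real (sqrt 2) * (d k *
        exp (- (\<i> / of_real (2 * B)) *
          of_real (A * (x\<^sup>2 - (of_int k)\<^sup>2 / 4) + 2 * p * (x - of_int k / 2))) *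
        \<phi> (2 * x - of_int k)) = (chirp S (of_int k / 2) * cnj (chirp S (of_int k / 2))) *
        (chirp S x * (b k * atom 1 k \<phi> x))"
      unfolding d atom1 by (simp only: mult_ac)
    then show ?thesis by simp
  qed
  have sa: "sa_atom S 0 0 \<psi> = (\<lambda>x. chirp S x * \<psi> x)"
    by (simp add: sa_atom_eq chirp_def)
  show ?thesis
    unfolding summand
  proof (intro bexI[of _ \<psi>] conjI)
    show "L2_has_sum (\<lambda>k x. chirp S x * (b k * atom 1 k \<phi> x)) (sa_atom S 0 0 \<psi>)"
      unfolding sa by (rule u.L2_has_sum_mult[OF \<psi>_expansion])
  qed (rule sa_atom_basis[OF wavelet_basis], rule \<psi>_L2)
qed

end
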